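(* Let $n\ge3$ and $\ell\ge1$ be integers. There exist pairwise distinct non-zero integers $a_1,\dots,a_{n-1}$ such that the polynomial $$f(t,x)=(x-a_1)\cdots(x-a_{n-1})\left(x-(-1)^{n-1}\frac{t^\ell-1}{a_1\cdots a_{n-1}}\right)-1\in\mathbb Q[t,x]$$ has Galois group $\mathcal S_n$ (as a polynomial in $x$) over $\mathbb Q(t)$, and the polynomial $f(0,x)\in\mathbb Q[x]$ is separable. *)

theory Defs
  imports "HOL-Algebra.Algebraic_Closure_Type" "HOL-Algebra.Sym_Groups"
          "HOL-Computational_Algebra.Polynomial_Factorial"
begin

definition is_subfield :: "'a::field set \<Rightarrow> bool" where
  "is_subfield S \<longleftrightarrow> 0 \<in> S \<and> 1 \<in> S \<and> (\<forall>x\<in>S. \<forall>y\<in>S. x + y \<in> S \<and> x * y \<in> S)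
      \<and> (\<forall>x\<in>S. - x \<in> S \<and> inverse x \<in> S)"

definition poly_roots_ac :: "'k::field poly \<Rightarrow> 'k alg_closure set" where
  "poly_roots_ac p = {z. poly (map_poly to_ac p) z = 0}"

definition splitting_field_ac :: "'k::field poly \<Rightarrow> 'k alg_closure set" where
  "splitting_field_ac p =
     \<Inter>{S. is_subfield S \<and> range to_ac \<subseteq> S \<and> poly_roots_ac p \<subseteq> S}"

definition galois_auts :: "'k::field poly \<Rightarrow> ('k alg_closure \<Rightarrow> 'k alg_closure) set" where
  "galois_auts p = (let L = splitting_field_ac p in
     {\<sigma>. \<sigma> \<in> extensional L \<and> bij_betw \<sigma> L L
        \<and> (\<forall>x\<in>L. \<forall>y\<in>L. \<sigma> (x + y) = \<sigma> x + \<sigma> y \<and> \<sigma> (x * y) = \<sigma> x * \<sigma> y)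
        \<and> \<sigma> 1 = 1
        \<and> (\<forall>c. \<sigma> (to_ac c) = to_ac c)})"

definition galois_group :: "'k::field poly \<Rightarrow> ('k alg_closure \<Rightarrow> 'k alg_closure) monoid" where
  "galois_group p = \<lparr> carrier = galois_auts p,
     monoid.mult = (\<lambda>\<sigma> \<tau>. restrict (\<sigma> \<circ> \<tau>) (splitting_field_ac p)),
     monoid.one = restrict id (splitting_field_ac p) \<rparr>"

definition separable_poly :: "'a::field poly \<Rightarrow> bool" where
  "separable_poly p \<longleftrightarrow> coprime p (pderiv p)"

text \<open>The bivariate polynomial f(t,x) of the paper, as an element of (Q[t])[x]
  (outer variable x, coefficients polynomials in t). The a_i are a 0..n-2.\<close>
definition fpoly :: "nat \<Rightarrow> nat \<Rightarrow> (nat \<Rightarrow> int) \<Rightarrow> rat poly poly" where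
  "fpoly n l a =
     (\<Prod>i<n-1. [:- [:rat_of_int (a i):], 1:])
     * [:- smult ((-1) ^ (n-1) / (\<Prod>i<n-1. rat_of_int (a i))) ([:0, 1:] ^ l - 1), 1:]
     - 1"

definition fpoly_Qt :: "nat \<Rightarrow> nat \<Rightarrow> (nat \<Rightarrow> int) \<Rightarrow> rat poly fract poly" where
  "fpoly_Qt n l a = map_poly to_fract (fpoly n l a)"

definition fpoly_at0 :: "nat \<Rightarrow> nat \<Rightarrow> (nat \<Rightarrow> int) \<Rightarrow> rat poly" where
  "fpoly_at0 n l a = map_poly (\<lambda>c. poly c 0) (fpoly n l a)"

end

theory Submission
  imports Defs "HOL-Computational_Algebra.Computational_Algebra"
begin

text \<open>
  Take \<open>a_i = -5 (i + 1)\<close>, let \<open>g\<close> be the product of the \<open>x - a_i\<close>, and write the equation as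
  \<open>g(x) (x - s) = 1\<close> with \<open>s = (t^l - 1) / M\<close>, where \<open>M\<close> is the product of the \<open>5 (i + 1)\<close>.
  Over \<open>\<rat>(s)\<close> the Galois group is doubly transitive: pairs of distinct roots are zeros of
  \<open>g(x) g(y) + (g(x) - g(y)) / (x - y)\<close>, which is irreducible by an Eisenstein argument at 5 and infinity.
  A real analysis of \<open>x - 1 / g(x)\<close> gives a critical value \<open>sc\<close> with \<open>M sc \<noteq> -1\<close> over which one root is double and all
  others are simple.  In the Laurent series in \<open>u\<close> with \<open>s = sc + u^2\<close> the equation splits, and
  \<open>u \<mapsto> -u\<close> swaps two roots and fixes the others.  By double transitivity the splitting field embeds there with
  any prescribed pair of roots as the swapped one.  Such an embedding sends \<open>t\<close> to a complex root of unity
  times a series in \<open>u^2\<close>, so the reflection fixes \<open>t\<close> and every transposition lies in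
  the Galois group over \<open>\<rat>(t)\<close>, whatever \<open>l\<close> is.
\<close>

text \<open>The spacing 5 serves twice. Midway between neighbouring zeros every factor of g has
  absolute value at least 5/2, so |g| is at least 1 there and sign changes locate the real roots;
  and 5 divides every a_i, the congruence behind the irreducibility of the pair polynomial. The
  obstacle is the passage from s to t: a symmetric group over Q(s) may shrink over Q(t). The
  condition M sc + 1 \<noteq> 0 says that t^l = M s + 1 does not vanish at the critical value, so t
  does not ramify there. It holds by size, since M \<ge> 5 and sc < -6. No Galois group over Q(s) is
  ever formed. Double transitivity enters as equality of kernels: evaluation of integer polynomials
  at a pair of distinct roots has the same kernel for every pair, in the closure of Q(t) and in the
  Laurent series alike. This gives an embedding of the field generated by the pair, which is then
  extended to t and to the other roots. The choices made there are harmless, because the reflection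
  fixes all values that remain possible. At t = 0 the parameter is s = -1/M, between -1 and 0, where
  all roots are real and distinct.\<close>

subsection \<open>Extension of partial homomorphisms\<close>

text \<open>A linear factor at whose zero \<open>m\<close> does not vanish can be cancelled from the
  cofactor. If this happened for all factors, \<open>m\<close> would divide 1. No field is assumed,
  so this also serves integer polynomials.\<close>

lemma dvd_prod_linear_imp_root:
  fixes m :: "'a::idom poly"
  assumes "finite S" "m dvd (\<Prod>b\<in>S. [:-b, 1:])" "degree m > 0"
  shows "\<exists>b\<in>S. poly m b = 0"
  using assms
proof (induction S arbitrary: m rule: finite_induct)
  case empty
  then have "m dvd 1" by simp
  then have "degree m \<le> degree (1 :: 'a poly)" by (rule dvd_imp_degree_le) simp
  with empty show ?case by simp
next
  case (insert b S)
  from insert.prems obtain q where q: "[:-b, 1:] * (\<Prod>b\<in>S. [:-b, 1:]) = m * q"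
    using insert.hyps by (auto elim!: dvdE)
  show ?case
  proof (cases "poly m b = 0")
    case False
    have "poly (m * q) b = 0" by (simp flip: q)
    with False have "poly q b = 0" by simp
    then obtain q' where "q = [:-b, 1:] * q'" by (auto simp: poly_eq_0_iff_dvd elim!: dvdE)
    then have "m * q = [:-b, 1:] * (m * q')" using mult.left_commute by blast
    with q have "[:-b, 1:] * (\<Prod>b\<in>S. [:-b, 1:]) = [:-b, 1:] * (m * q')" by (rule trans)
    then have "(\<Prod>b\<in>S. [:-b, 1:]) = m * q'" by (subst (asm) mult_cancel_left) auto
    then have "m dvd (\<Prod>b\<in>S. [:-b, 1:])" by simp
    with insert show ?thesis by blast
  qed auto
qed

lemma monic_eq_prod_roots:
  fixes p :: "'a::idom poly"
  assumes "finite S" "lead_coeff p = 1" "degree p = card S" "\<And>x. x \<in> S \<Longrightarrow> poly p x = 0"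
  shows "p = (\<Prod>x\<in>S. [:-x, 1:])"
  using assms
proof (induction S arbitrary: p rule: finite_induct)
  case empty
  then show ?case by (metis card.empty monom_eq_1 degree_0_id pCons_one prod.empty lead_coeff_pCons(2) degree_eq_zeroE degree_pCons_0 coeff_pCons_0)
next
  case (insert b S)
  have "poly p b = 0" using insert by simp
  then obtain q where q: "p = [:-b, 1:] * q" by (auto simp: poly_eq_0_iff_dvd elim!: dvdE)
  have "q \<noteq> 0" using insert.prems q by auto
  have lc: "lead_coeff q = 1" using insert.prems(1) unfolding q lead_coeff_mult by simp
  have "degree p = Suc (degree q)" unfolding q using \<open>q \<noteq> 0\<close> by (subst degree_mult_eq) auto
  then have deg: "degree q = card S" using insert by simp
  have "poly q x = 0" if "x \<in> S" for x
    using insert.prems(3)[of x] insert.hyps that unfolding q by auto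
  from insert.IH[OF lc deg this] show ?case using q insert.hyps by simp
qed

text \<open>The domain is a set so that a map can be extended by enlarging the set; values outside
  it are arbitrary. On \<open>UNIV\<close> this is an ordinary ring homomorphism.\<close>

definition hom_on :: "'a::comm_ring_1 set \<Rightarrow> ('a \<Rightarrow> 'b::comm_ring_1) \<Rightarrow> bool" where
  "hom_on E h \<longleftrightarrow> h 1 = 1 \<and> (\<forall>x\<in>E. \<forall>y\<in>E. h (x + y) = h x + h y \<and> h (x * y) = h x * h y)"

definition polys_over :: "'a::zero set \<Rightarrow> 'a poly set" where
  "polys_over E = {p. \<forall>i. coeff p i \<in> E}"

locale subfield_hom =
  fixes E :: "'a::field set" and h :: "'a \<Rightarrow> 'b::field"
  assumes subfield: "is_subfield E" and hom: "hom_on E h"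
begin

lemma zero_mem [simp]: "0 \<in> E" and one_mem [simp]: "1 \<in> E"
  and add_mem: "x \<in> E \<Longrightarrow> y \<in> E \<Longrightarrow> x + y \<in> E"
  and mult_mem: "x \<in> E \<Longrightarrow> y \<in> E \<Longrightarrow> x * y \<in> E"
  and uminus_mem: "x \<in> E \<Longrightarrow> - x \<in> E"
  and inverse_mem: "x \<in> E \<Longrightarrow> inverse x \<in> E"
  using subfield by (auto simp: is_subfield_def)

lemma diff_mem: "x \<in> E \<Longrightarrow> y \<in> E \<Longrightarrow> x - y \<in> E"
  using add_mem[of x "-y"] uminus_mem by simp

lemma divide_mem: "x \<in> E \<Longrightarrow> y \<in> E \<Longrightarrow> x / y \<in> E"
  using mult_mem[of x "inverse y"] inverse_mem by (simp add: field_simps)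

lemma sum_mem: "(\<And>i. i \<in> A \<Longrightarrow> f i \<in> E) \<Longrightarrow> sum f A \<in> E"
  by (induction A rule: infinite_finite_induct) (auto intro: add_mem)

lemma of_nat_mem: "of_nat n \<in> E"
  by (induction n) (auto intro: add_mem)

lemma of_int_mem: "of_int n \<in> E"
  by (cases n) (auto intro: of_nat_mem uminus_mem diff_mem simp del: of_nat_Suc)

lemma hom_1 [simp]: "h 1 = 1"
  and hom_add: "x \<in> E \<Longrightarrow> y \<in> E \<Longrightarrow> h (x + y) = h x + h y"
  and hom_mult: "x \<in> E \<Longrightarrow> y \<in> E \<Longrightarrow> h (x * y) = h x * h y"
  using hom by (auto simp: hom_on_def)

lemma hom_0 [simp]: "h 0 = 0"
  using hom_add[of 0 0] unfolding add_0_left by (simp only: zero_mem simp_thms add_cancel_right_right)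

lemma hom_uminus: "x \<in> E \<Longrightarrow> h (- x) = - h x"
  using hom_add[of x "-x"] uminus_mem by (simp add: eq_neg_iff_add_eq_0 add.commute)

lemma hom_diff: "x \<in> E \<Longrightarrow> y \<in> E \<Longrightarrow> h (x - y) = h x - h y"
  using hom_add[of x "-y"] uminus_mem hom_uminus by simp

lemma hom_eq_0_iff: "x \<in> E \<Longrightarrow> h x = 0 \<longleftrightarrow> x = 0"
  using hom_mult[of x "inverse x"] inverse_mem by (cases "x = 0") auto

lemma hom_eq_iff: "x \<in> E \<Longrightarrow> y \<in> E \<Longrightarrow> h x = h y \<longleftrightarrow> x = y"
  using hom_eq_0_iff[of "x - y"] diff_mem hom_diff by auto

lemma hom_inverse: "x \<in> E \<Longrightarrow> h (inverse x) = inverse (h x)"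
  using hom_mult[of x "inverse x"] inverse_mem[of x]
  by (cases "x = 0") (auto intro!: inverse_unique[symmetric])

lemma hom_divide: "x \<in> E \<Longrightarrow> y \<in> E \<Longrightarrow> h (x / y) = h x / h y"
  using hom_mult[of x "inverse y"] inverse_mem hom_inverse by (simp add: field_simps)

lemma hom_sum: "(\<And>i. i \<in> A \<Longrightarrow> f i \<in> E) \<Longrightarrow> h (sum f A) = (\<Sum>i\<in>A. h (f i))"
  by (induction A rule: infinite_finite_induct) (auto simp: hom_add sum_mem)

lemma hom_of_nat: "h (of_nat n) = of_nat n"
  by (induction n) (auto simp: hom_add of_nat_mem)

lemma hom_of_int: "h (of_int n) = of_int n"
  by (cases n) (auto simp: hom_of_nat hom_diff hom_uminus of_nat_mem diff_mem simp del: of_nat_Suc)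

lemma polys_over_mem: "p \<in> polys_over E \<Longrightarrow> coeff p i \<in> E"
  by (simp add: polys_over_def)

lemma polys_over_0 [simp]: "0 \<in> polys_over E" and polys_over_1 [simp]: "1 \<in> polys_over E"
  by (auto simp: polys_over_def coeff_1)

lemma polys_over_pCons: "pCons a p \<in> polys_over E \<longleftrightarrow> a \<in> E \<and> p \<in> polys_over E"
  by (force simp: polys_over_def coeff_pCons split: nat.splits)

lemma polys_over_add: "p \<in> polys_over E \<Longrightarrow> q \<in> polys_over E \<Longrightarrow> p + q \<in> polys_over E"
  and polys_over_diff: "p \<in> polys_over E \<Longrightarrow> q \<in> polys_over E \<Longrightarrow> p - q \<in> polys_over E"
  and polys_over_uminus: "p \<in> polys_over E \<Longrightarrow> - p \<in> polys_over E"
  and polys_over_smult: "c \<in> E \<Longrightarrow> p \<in> polys_over E \<Longrightarrow> smult c p \<in> polys_over E"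
  and polys_over_mult: "p \<in> polys_over E \<Longrightarrow> q \<in> polys_over E \<Longrightarrow> p * q \<in> polys_over E"
  by (auto simp: polys_over_def coeff_mult intro!: add_mem diff_mem uminus_mem mult_mem sum_mem)

lemma polys_over_monom: "c \<in> E \<Longrightarrow> monom c n \<in> polys_over E"
  by (auto simp: polys_over_def)

lemma poly_mem: "p \<in> polys_over E \<Longrightarrow> x \<in> E \<Longrightarrow> poly p x \<in> E"
  by (induction p) (auto simp: polys_over_pCons intro: add_mem mult_mem)

lemma polys_over_div_mod:
  assumes "p \<in> polys_over E" "m \<in> polys_over E"
  shows "p div m \<in> polys_over E \<and> p mod m \<in> polys_over E"
  using assms
proof (induction p)
  case (pCons a p)
  then have *: "a \<in> E" "p div m \<in> polys_over E" "p mod m \<in> polys_over E"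
    by (auto simp: polys_over_pCons)
  then have "pCons a (p mod m) \<in> polys_over E" by (simp add: polys_over_pCons)
  with * pCons.prems show ?case
    by (auto simp: div_pCons_eq mod_pCons_eq polys_over_pCons
             intro!: divide_mem polys_over_mem polys_over_diff polys_over_smult)
qed auto

lemma coeff_map_hom [simp]: "coeff (map_poly h p) i = h (coeff p i)"
  by (simp add: coeff_map_poly)

lemma map_hom_pCons [simp]: "map_poly h (pCons a p) = pCons (h a) (map_poly h p)"
  by (rule poly_eqI) (auto simp: coeff_pCons split: nat.splits)

lemma map_hom_add: "p \<in> polys_over E \<Longrightarrow> q \<in> polys_over E \<Longrightarrow> map_poly h (p + q) = map_poly h p + map_poly h q"
  and map_hom_diff: "p \<in> polys_over E \<Longrightarrow> q \<in> polys_over E \<Longrightarrow> map_poly h (p - q) = map_poly h p - map_poly h q"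
  and map_hom_uminus: "p \<in> polys_over E \<Longrightarrow> map_poly h (- p) = - map_poly h p"
  and map_hom_mult: "p \<in> polys_over E \<Longrightarrow> q \<in> polys_over E \<Longrightarrow> map_poly h (p * q) = map_poly h p * map_poly h q"
  by (intro poly_eqI; simp add: coeff_mult hom_add hom_diff hom_uminus hom_sum hom_mult mult_mem polys_over_mem)+

lemma degree_map_hom: "p \<in> polys_over E \<Longrightarrow> degree (map_poly h p) = degree p"
  by (cases "p = 0") (auto intro!: map_poly_degree_eq simp: hom_eq_0_iff polys_over_mem)

lemma hom_poly: "p \<in> polys_over E \<Longrightarrow> x \<in> E \<Longrightarrow> h (poly p x) = poly (map_poly h p) (h x)"
  by (induction p) (auto simp: polys_over_pCons hom_add hom_mult mult_mem poly_mem)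

end

text \<open>A partial homomorphism is given by its graph, and extends to fractions once it respects zero in both directions.\<close>

lemma fraction_hom:
  fixes \<Gamma> :: "('a::field \<times> 'b::field) set"
  assumes one: "(1, 1) \<in> \<Gamma>"
    and add: "\<And>x y x' y'. (x, y) \<in> \<Gamma> \<Longrightarrow> (x', y') \<in> \<Gamma> \<Longrightarrow> (x + x', y + y') \<in> \<Gamma>"
    and mult: "\<And>x y x' y'. (x, y) \<in> \<Gamma> \<Longrightarrow> (x', y') \<in> \<Gamma> \<Longrightarrow> (x * x', y * y') \<in> \<Gamma>"
    and uminus: "\<And>x y. (x, y) \<in> \<Gamma> \<Longrightarrow> (- x, - y) \<in> \<Gamma>"
    and zero: "\<And>x y. (x, y) \<in> \<Gamma> \<Longrightarrow> x = 0 \<longleftrightarrow> y = 0"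
  shows "\<exists>E h. subfield_hom E h \<and> (\<forall>(x, y)\<in>\<Gamma>. x \<in> E \<and> h x = y)"
proof -
  define Q where "Q = (\<lambda>z w. \<exists>x y x' y'. (x, y) \<in> \<Gamma> \<and> (x', y') \<in> \<Gamma> \<and> x' \<noteq> 0 \<and> z = x / x' \<and> w = y / y')"
  have Q_unique: "w = w'" if zw: "Q z w" and zw': "Q z w'" for z w w'
  proof -
    from zw obtain x y x' y' where 1: "(x, y) \<in> \<Gamma>" "(x', y') \<in> \<Gamma>" "x' \<noteq> 0" "z = x / x'" "w = y / y'"
      unfolding Q_def by blast
    from zw' obtain u v u' v' where 2: "(u, v) \<in> \<Gamma>" "(u', v') \<in> \<Gamma>" "u' \<noteq> 0" "z = u / u'" "w' = v / v'"
      unfolding Q_def by blast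
    have "y' \<noteq> 0" "v' \<noteq> 0" using zero 1(2,3) 2(2,3) by blast+
    \<comment> \<open>Equality of the two fractions makes the left cross difference vanish, and
      \<open>zero\<close> carries this over to the right coordinate.\<close>
    have "(x * u' + - (u * x'), y * v' + - (v * y')) \<in> \<Gamma>"
      using 1 2 by (intro add uminus mult)
    moreover have "x * u' + - (u * x') = 0" using 1 2 by (simp add: field_simps)
    ultimately have "y * v' + - (v * y') = 0" using zero by blast
    with \<open>y' \<noteq> 0\<close> \<open>v' \<noteq> 0\<close> have "y / y' = v / v'" by (simp add: field_simps)
    with 1 2 show ?thesis by simp
  qed
  define E where "E = {z. \<exists>w. Q z w}"
  define h where "h = (\<lambda>z. THE w. Q z w)"
  have h: "h z = w" if "Q z w" for z w
    unfolding h_def using that Q_unique by blast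
  have Q\<Gamma>: "Q x y" if "(x, y) \<in> \<Gamma>" for x y
    unfolding Q_def using that one by (intro exI[of _ x] exI[of _ y] exI[of _ 1]) auto
  have Q0: "Q 0 0" using Q\<Gamma>[OF add[OF one uminus[OF one]]] by simp
  have Q1: "Q 1 1" using Q\<Gamma>[OF one] .
  have Qadd: "Q (z + z') (w + w')" and Qmult: "Q (z * z') (w * w')"
    if zw: "Q z w" and zw': "Q z' w'" for z w z' w'
  proof -
    from zw obtain x y x' y' where 1: "(x, y) \<in> \<Gamma>" "(x', y') \<in> \<Gamma>" "x' \<noteq> 0" "z = x / x'" "w = y / y'"
      unfolding Q_def by blast
    from zw' obtain u v u' v' where 2: "(u, v) \<in> \<Gamma>" "(u', v') \<in> \<Gamma>" "u' \<noteq> 0" "z' = u / u'" "w' = v / v'"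
      unfolding Q_def by blast
    have nz: "y' \<noteq> 0" "v' \<noteq> 0" using zero 1(2,3) 2(2,3) by blast+
    have 3: "(x' * u', y' * v') \<in> \<Gamma>" using 1 2 by (intro mult)
    have "(x * u' + u * x', y * v' + v * y') \<in> \<Gamma>" using 1 2 by (intro add mult)
    moreover have "z + z' = (x * u' + u * x') / (x' * u')" "w + w' = (y * v' + v * y') / (y' * v')"
      using 1 2 nz by (auto simp: field_simps)
    ultimately show "Q (z + z') (w + w')" unfolding Q_def using 3 1(3) 2(3)
      by (intro exI conjI) auto
    have "(x * u, y * v) \<in> \<Gamma>" using 1 2 by (intro mult)
    moreover have "z * z' = (x * u) / (x' * u')" "w * w' = (y * v) / (y' * v')"
      using 1 2 by auto
    ultimately show "Q (z * z') (w * w')" unfolding Q_def using 3 1(3) 2(3)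
      by (intro exI conjI) auto
  qed
  have Qinv: "Q (inverse z) (inverse w)" and Qneg: "Q (- z) (- w)" if zw: "Q z w" for z w
  proof -
    from zw obtain x y x' y' where 1: "(x, y) \<in> \<Gamma>" "(x', y') \<in> \<Gamma>" "x' \<noteq> 0" "z = x / x'" "w = y / y'"
      unfolding Q_def by blast
    have "z = 0 \<Longrightarrow> w = 0" using Q_unique[OF Q0] zw by blast
    moreover have "Q (x' / x) (y' / y)" if "x \<noteq> 0"
      unfolding Q_def using 1 that by blast
    ultimately show "Q (inverse z) (inverse w)"
      using Q0 1(4,5) by (cases "z = 0") auto
    show "Q (- z) (- w)" using 1 uminus[OF 1(1)] unfolding Q_def
      by (intro exI[of _ "-x"] exI[of _ "-y"] exI[of _ x'] exI[of _ y']) auto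
  qed
  have "is_subfield E"
    unfolding is_subfield_def
  proof (intro conjI ballI)
    show "0 \<in> E" "1 \<in> E" using Q0 Q1 unfolding E_def by blast+
    fix z assume "z \<in> E"
    then obtain w where w: "Q z w" unfolding E_def by blast
    show "- z \<in> E" "inverse z \<in> E" using Qneg[OF w] Qinv[OF w] unfolding E_def by blast+
    fix z' assume "z' \<in> E"
    then obtain w' where w': "Q z' w'" unfolding E_def by blast
    show "z + z' \<in> E" "z * z' \<in> E" using Qadd[OF w w'] Qmult[OF w w'] unfolding E_def by blast+
  qed
  moreover have "hom_on E h"
    unfolding hom_on_def
  proof (intro conjI ballI)
    show "h 1 = 1" using h[OF Q1] .
    fix z z' assume "z \<in> E" "z' \<in> E"
    then obtain w w' where w: "Q z w" "Q z' w'" unfolding E_def by blast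
    show "h (z + z') = h z + h z'" "h (z * z') = h z * h z'"
      using h[OF w(1)] h[OF w(2)] h[OF Qadd[OF w]] h[OF Qmult[OF w]] by simp_all
  qed
  ultimately show ?thesis
    using Q\<Gamma> h by (intro exI[of _ E] exI[of _ h]) (auto simp: subfield_hom_def E_def)
qed

text \<open>The minimal polynomial of \<open>a\<close> divides \<open>q\<close>, so its image
  divides a split polynomial and has a root \<open>b\<close>. Sending \<open>a\<close> to
  \<open>b\<close> is well defined and injective because a polynomial over \<open>E\<close> vanishes
  at \<open>a\<close> exactly when its image vanishes at \<open>b\<close>.\<close>

lemma (in subfield_hom) extend_adjoin:
  assumes q: "q \<in> polys_over E" "q \<noteq> 0" "poly q a = 0"
    and S: "finite S" "map_poly h q = (\<Prod>b\<in>S. [:-b, 1:])"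
  shows "\<exists>E' h'. subfield_hom E' h' \<and> insert a E \<subseteq> E' \<and> (\<forall>x\<in>E. h' x = h x)"
proof -
  \<comment> \<open>A nonzero annihilator of \<open>a\<close> of least degree plays the role of the
    minimal polynomial.\<close>
  define P where "P = (\<lambda>m. m \<in> polys_over E \<and> m \<noteq> 0 \<and> poly m a = 0)"
  have "P q" using q by (simp add: P_def)
  then obtain m where "P m" and min: "\<And>p. P p \<Longrightarrow> degree m \<le> degree p"
    using ex_has_least_nat[of P q degree] by blast
  then have m: "m \<in> polys_over E" "m \<noteq> 0" "poly m a = 0" by (auto simp: P_def)
  have dvd: "p = m * (p div m)" if p: "p \<in> polys_over E" "poly p a = 0" for p
  proof -
    have "poly (p mod m) a = poly (p - m * (p div m)) a" by (simp add: minus_mult_div_eq_mod)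
    also have "\<dots> = 0" using p m by simp
    finally have "p mod m = 0"
      using min[of "p mod m"] polys_over_div_mod[OF p(1) m(1)] degree_mod_less[OF m(2), of p]
      by (cases "p mod m = 0") (simp_all add: P_def)
    then show ?thesis by (simp add: dvd_eq_mod_eq_0)
  qed
  have deg_m: "degree m > 0"
    using m by (metis degree_eq_zeroE gr0I mult_zero_right pCons_0_0 poly_0 poly_pCons add_0_right)
  have hdvd: "map_poly h p = map_poly h m * map_poly h (p div m)"
    if p: "p \<in> polys_over E" "poly p a = 0" for p
    using dvd[OF p] map_hom_mult[OF m(1)] polys_over_div_mod[OF p(1) m(1)] by metis
  from hdvd[OF q(1,3)] have "map_poly h m dvd (\<Prod>b\<in>S. [:-b, 1:])"
    by (metis S(2) dvd_triv_left)
  from dvd_prod_linear_imp_root[OF S(1) this]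
  obtain b where b: "poly (map_poly h m) b = 0"
    using deg_m degree_map_hom[OF m(1)] by auto
  have 1: "poly (map_poly h p) b = 0" if "p \<in> polys_over E" "poly p a = 0" for p
    using hdvd[OF that] b by simp
  have hmod: "poly (map_poly h (p mod r)) b = poly (map_poly h p) b - poly (map_poly h r) b * poly (map_poly h (p div r)) b"
    if p: "p \<in> polys_over E" "r \<in> polys_over E" for p r
  proof -
    have "p mod r = p - r * (p div r)" by (simp add: minus_mult_div_eq_mod)
    then have "map_poly h (p mod r) = map_poly h p - map_poly h r * map_poly h (p div r)"
      using p polys_over_div_mod[OF p] by (simp add: map_hom_mult map_hom_diff polys_over_mult)
    then show ?thesis by simp
  qed
  \<comment> \<open>Irreducibility of \<open>m\<close> in disguise: a counterexample
    \<open>r\<close> of least degree has smaller degree than \<open>m\<close> and divides it. The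
    cofactor then kills \<open>a\<close>, so minimality of \<open>m\<close> makes \<open>r\<close>
    constant, and a nonzero constant does not map to 0.\<close>
  have 2: "poly p a = 0" if p: "p \<in> polys_over E" "poly (map_poly h p) b = 0" for p
  proof (rule ccontr)
    assume pa: "poly p a \<noteq> 0"
    define Z where "Z = (\<lambda>r. r \<in> polys_over E \<and> poly (map_poly h r) b = 0 \<and> poly r a \<noteq> 0)"
    have "Z p" using p pa by (simp add: Z_def)
    then obtain r where r': "Z r" and minr: "\<And>p. Z p \<Longrightarrow> degree r \<le> degree p"
      using ex_has_least_nat[of Z p degree] by blast
    then have r: "r \<in> polys_over E" "poly (map_poly h r) b = 0" "poly r a \<noteq> 0" by (auto simp: Z_def)
    have "r \<noteq> 0" using r by auto
    have "Z (r mod m)"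
      unfolding Z_def using r m b hmod[OF r(1) m(1)] polys_over_div_mod[OF r(1) m(1)]
      by (simp flip: minus_mult_div_eq_mod)
    then have "degree r < degree m"
      using minr[of "r mod m"] degree_mod_less[OF m(2), of r] by (auto simp: Z_def)
    have rm: "m mod r \<in> polys_over E" "m div r \<in> polys_over E" using polys_over_div_mod m r by auto
    have "poly (map_poly h (m mod r)) b = 0" using hmod[OF m(1) r(1)] r b by simp
    then have "m mod r = 0"
      using minr[of "m mod r"] degree_mod_less[OF \<open>r \<noteq> 0\<close>, of m] min[of "m mod r"] \<open>degree r < degree m\<close> rm
      by (cases "poly (m mod r) a = 0"; cases "m mod r = 0") (simp_all add: Z_def P_def)
    then have mr: "m = r * (m div r)" by (simp add: dvd_eq_mod_eq_0)
    have nz: "m div r \<noteq> 0" using mr m(2) by auto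
    have "poly (m div r) a = 0" using m(3) r(3) mr by (metis mult_eq_0_iff poly_mult)
    then have "degree m \<le> degree (m div r)" using min[of "m div r"] rm nz by (auto simp: P_def)
    then have "degree r = 0" using mr degree_mult_eq[OF \<open>r \<noteq> 0\<close> nz] by simp
    then obtain c where "r = [:c:]" by (auto elim: degree_eq_zeroE)
    with r \<open>r \<noteq> 0\<close> show False by (auto simp: hom_eq_0_iff polys_over_pCons)
  qed
  define \<Gamma> where "\<Gamma> = (\<lambda>p. (poly p a, poly (map_poly h p) b)) ` polys_over E"
  have \<Gamma>I: "(x, y) \<in> \<Gamma>" if "p \<in> polys_over E" "x = poly p a" "y = poly (map_poly h p) b" for p x y
    using that by (auto simp: \<Gamma>_def)
  have "\<exists>E' h'. subfield_hom E' h' \<and> (\<forall>(x, y)\<in>\<Gamma>. x \<in> E' \<and> h' x = y)"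
  proof (rule fraction_hom)
    show "(1, 1) \<in> \<Gamma>" by (rule \<Gamma>I[of 1]) (auto simp: map_poly_1)
    show "(x + x', y + y') \<in> \<Gamma>" if xy: "(x, y) \<in> \<Gamma>" "(x', y') \<in> \<Gamma>" for x y x' y'
    proof -
      from xy obtain p p' where "p \<in> polys_over E" "p' \<in> polys_over E"
        "x = poly p a" "x' = poly p' a" "y = poly (map_poly h p) b" "y' = poly (map_poly h p') b"
        by (auto simp: \<Gamma>_def)
      then show ?thesis by (intro \<Gamma>I[of "p + p'"]) (auto simp: polys_over_add map_hom_add)
    qed
    show "(x * x', y * y') \<in> \<Gamma>" if xy: "(x, y) \<in> \<Gamma>" "(x', y') \<in> \<Gamma>" for x y x' y'
    proof -
      from xy obtain p p' where "p \<in> polys_over E" "p' \<in> polys_over E"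
        "x = poly p a" "x' = poly p' a" "y = poly (map_poly h p) b" "y' = poly (map_poly h p') b"
        by (auto simp: \<Gamma>_def)
      then show ?thesis by (intro \<Gamma>I[of "p * p'"]) (auto simp: polys_over_mult map_hom_mult)
    qed
    show "(- x, - y) \<in> \<Gamma>" if xy: "(x, y) \<in> \<Gamma>" for x y
    proof -
      from xy obtain p where "p \<in> polys_over E" "x = poly p a" "y = poly (map_poly h p) b"
        by (auto simp: \<Gamma>_def)
      then show ?thesis by (intro \<Gamma>I[of "- p"]) (auto simp: polys_over_uminus map_hom_uminus)
    qed
    show "(x = 0) = (y = 0)" if "(x, y) \<in> \<Gamma>" for x y
      using that 1 2 by (auto simp: \<Gamma>_def)
  qed
  then obtain E' h' where E': "subfield_hom E' h'" and \<Gamma>: "\<And>x y. (x, y) \<in> \<Gamma> \<Longrightarrow> x \<in> E' \<and> h' x = y"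
    by fast
  have "(a, b) \<in> \<Gamma>" by (rule \<Gamma>I[of "[:0, 1:]"]) (auto simp: polys_over_pCons)
  moreover have "(x, h x) \<in> \<Gamma>" if "x \<in> E" for x
    using that by (intro \<Gamma>I[of "[:x:]"]) (auto simp: polys_over_pCons)
  ultimately show ?thesis using E' \<Gamma> by (intro exI[of _ E'] exI[of _ h']) auto
qed

text \<open>All the polynomials lie over the initial \<open>E\<close>, where every later map agrees
  with \<open>h\<close>. Hence they stay split while the elements are adjoined one at a
  time.\<close>

lemma (in subfield_hom) extend_adjoin_finite:
  assumes "finite A"
    and "\<And>a. a \<in> A \<Longrightarrow> \<exists>q S. q \<in> polys_over E \<and> q \<noteq> 0 \<and> poly q a = 0 \<and>
           finite S \<and> map_poly h q = (\<Prod>b\<in>S. [:-b, 1:])"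
  shows "\<exists>E' h'. subfield_hom E' h' \<and> A \<union> E \<subseteq> E' \<and> (\<forall>x\<in>E. h' x = h x)"
  using assms
proof (induction A rule: finite_induct)
  case empty
  show ?case using subfield_hom_axioms by auto
next
  case (insert a A)
  then obtain E1 h1 where 1: "subfield_hom E1 h1" "A \<union> E \<subseteq> E1" "\<And>x. x \<in> E \<Longrightarrow> h1 x = h x"
    by blast
  from insert.prems[of a] obtain q S where q: "q \<in> polys_over E" "q \<noteq> 0" "poly q a = 0"
    "finite S" "map_poly h q = (\<Prod>b\<in>S. [:-b, 1:])" by auto
  have "q \<in> polys_over E1" using q 1 by (auto simp: polys_over_def)
  moreover have "map_poly h1 q = map_poly h q"
    using 1 q(1) by (intro poly_eqI) (simp add: coeff_map_poly subfield_hom.hom_0 polys_over_mem)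
  ultimately obtain E2 h2 where "subfield_hom E2 h2" "insert a E1 \<subseteq> E2" "\<forall>x\<in>E1. h2 x = h1 x"
    using subfield_hom.extend_adjoin[OF 1(1), of q a S] q by auto
  with 1 show ?case by (intro exI[of _ E2] exI[of _ h2]) auto
qed
subsection \<open>The polynomial of pairs of roots\<close>

text \<open>The total counterpart of \<open>subfield_hom\<close>, for sources such as rings of
  integer polynomials that are not fields.\<close>

locale type_hom =
  fixes h :: "'a::comm_ring_1 \<Rightarrow> 'b::comm_ring_1"
  assumes hom: "hom_on UNIV h"
begin

lemma hom_1 [simp]: "h 1 = 1"
  and hom_add: "h (x + y) = h x + h y"
  and hom_mult: "h (x * y) = h x * h y"
  using hom by (auto simp: hom_on_def)

lemma hom_0 [simp]: "h 0 = 0"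
  using hom_add[of 0 0] unfolding add_0_left by (simp only: add_cancel_right_right)

lemma hom_uminus: "h (- x) = - h x"
  using hom_add[of x "-x"] by (simp add: eq_neg_iff_add_eq_0 add.commute)

lemma hom_diff: "h (x - y) = h x - h y"
  using hom_add[of x "-y"] hom_uminus by simp

lemma hom_sum: "h (sum f A) = (\<Sum>i\<in>A. h (f i))"
  by (induction A rule: infinite_finite_induct) (auto simp: hom_add)

lemma hom_prod: "h (prod f A) = (\<Prod>i\<in>A. h (f i))"
  by (induction A rule: infinite_finite_induct) (auto simp: hom_mult)

lemma hom_power: "h (x ^ n) = h x ^ n"
  by (induction n) (auto simp: hom_mult)

lemma hom_of_nat: "h (of_nat n) = of_nat n"
  by (induction n) (auto simp: hom_add)

lemma hom_of_int: "h (of_int n) = of_int n"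
  by (cases n) (auto simp: hom_of_nat hom_diff hom_uminus simp del: of_nat_Suc)

lemma coeff_map_hom [simp]: "coeff (map_poly h p) i = h (coeff p i)"
  by (simp add: coeff_map_poly)

lemma map_hom_pCons [simp]: "map_poly h (pCons a p) = pCons (h a) (map_poly h p)"
  by (rule poly_eqI) (auto simp: coeff_pCons split: nat.splits)

lemma map_hom: "hom_on UNIV (map_poly h)"
  by (auto simp: hom_on_def map_poly_1 one_pCons[symmetric] poly_eq_iff coeff_mult hom_add hom_sum hom_mult)

lemma eval_hom: "hom_on UNIV (\<lambda>p. poly (map_poly h p) x)"
  using map_hom by (auto simp: hom_on_def)

end

lemma hom_on_of_int: "hom_on UNIV of_int"
  by (auto simp: hom_on_def)

lemma hom_on_const_poly: "hom_on UNIV (\<lambda>c. [:c:])"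
  by (auto simp: hom_on_def one_pCons)

text \<open>Pseudo-division by a kernel element of least degree.\<close>

lemma prime_elem_dvd_if_root:
  fixes h :: "'a::idom \<Rightarrow> 'b::idom"
  assumes h: "hom_on UNIV h" and inj: "\<And>x. h x = 0 \<Longrightarrow> x = 0"
    and P: "prime_elem P" "poly (map_poly h P) a = 0"
    and A: "poly (map_poly h A) a = 0"
  shows "P dvd A"
proof -
  interpret h: type_hom h by unfold_locales (rule h)
  interpret ev: type_hom "\<lambda>p. poly (map_poly h p) a" by unfold_locales (rule h.eval_hom)
  have const: "p = 0" if "degree p = 0" "poly (map_poly h p) a = 0" for p
  proof -
    from that obtain c where "p = [:c:]" by (auto elim: degree_eq_zeroE)
    with that inj show ?thesis by auto
  qed
  have P0: "P \<noteq> 0" using P(1) by auto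
  define K where "K = (\<lambda>p. p \<noteq> 0 \<and> poly (map_poly h p) a = 0)"
  have "K P" using P P0 by (simp add: K_def)
  then obtain m where "K m" and min: "\<And>p. K p \<Longrightarrow> degree m \<le> degree p"
    using ex_has_least_nat[of K P degree] by blast
  then have m: "m \<noteq> 0" "poly (map_poly h m) a = 0" by (auto simp: K_def)
  \<comment> \<open>Over a domain, division by \<open>m\<close> works up to a nonzero constant, and
    the remainder is a kernel element of too small degree.\<close>
  have *: "\<exists>c q. c \<noteq> 0 \<and> smult c B = m * q" if B: "poly (map_poly h B) a = 0" for B
  proof -
    obtain c q where cq: "c \<noteq> 0" "smult c B = m * q + pseudo_mod B m"
      using pseudo_mod(1)[OF m(1), of B] by blast
    have "poly (map_poly h (smult c B)) a = 0"
      using B ev.hom_mult[of "[:c:]" B] by simp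
    then have "poly (map_poly h (pseudo_mod B m)) a = 0"
      unfolding cq(2) ev.hom_add ev.hom_mult using m by simp
    then have "pseudo_mod B m = 0"
      using pseudo_mod(2)[OF m(1), of B] min[of "pseudo_mod B m"] by (cases "pseudo_mod B m = 0") (simp_all add: K_def)
    with cq show ?thesis by auto
  qed
  have "degree m > 0" using const m by blast
  have "degree P > 0" using const P P0 by blast
  obtain c q where c: "c \<noteq> 0" "smult c P = m * q" using *[OF P(2)] by blast
  have "P dvd m * q" using c(2) by (metis dvd_refl dvd_smult)
  then have "P dvd m"
  proof (rule prime_elem_dvd_multD[OF P(1), THEN disjE])
    \<comment> \<open>Cancelling \<open>P\<close> would make the nonzero constant \<open>c\<close> a
      multiple of \<open>m\<close>, which has positive degree.\<close>
    assume "P dvd q"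
    then obtain q' where q': "q = P * q'" by (elim dvdE)
    have "P * [:c:] = P * (m * q')" using c(2) q' by (simp add: mult.left_commute)
    then have "[:c:] = m * q'" using P0 by (subst (asm) mult_cancel_left) auto
    then have "m dvd [:c:]" by simp
    then have "degree m \<le> degree [:c:]" using c(1) by (intro dvd_imp_degree_le) auto
    with \<open>degree m > 0\<close> show ?thesis by simp
  qed
  obtain c' q' where c': "c' \<noteq> 0" "smult c' A = m * q'" using *[OF A] by blast
  have "P dvd [:c':] * A" using \<open>P dvd m\<close> c'(2) by simp
  then show ?thesis
  proof (rule prime_elem_dvd_multD[OF P(1), THEN disjE])
    assume "P dvd [:c':]"
    then have "degree P \<le> degree [:c':]" using c'(1) by (intro dvd_imp_degree_le) auto
    with \<open>degree P > 0\<close> show ?thesis by simp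
  qed
qed

section \<open>Degrees in the inner variable\<close>

lemma coeff_mult_degree_le:
  assumes "degree p \<le> d" "degree q \<le> e"
  shows "coeff (p * q) (d + e) = coeff p d * coeff q e"
proof -
  have "coeff (p * q) (d + e) = (\<Sum>i\<le>d + e. coeff p i * coeff q (d + e - i))"
    by (simp add: coeff_mult)
  also have "\<dots> = (\<Sum>i\<in>{d}. coeff p i * coeff q (d + e - i))"
  proof (rule sum.mono_neutral_right)
    show "\<forall>i\<in>{..d + e} - {d}. coeff p i * coeff q (d + e - i) = 0"
    proof
      fix i assume "i \<in> {..d + e} - {d}"
      then consider "i > d" | "d + e - i > e" by fastforce
      then show "coeff p i * coeff q (d + e - i) = 0"
        using assms by cases (auto simp: coeff_eq_0)
    qed
  qed auto
  finally show ?thesis by simp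
qed

text \<open>For a polynomial in y and x with outer variable x, \<open>map_poly (\<lambda>c. coeff c d)\<close> is the coefficient of y^d.\<close>

lemma map_coeff_mult:
  fixes U V :: "'a::comm_ring_1 poly poly"
  assumes "\<And>i. degree (coeff U i) \<le> d" "\<And>i. degree (coeff V i) \<le> e"
  shows "map_poly (\<lambda>c. coeff c (d + e)) (U * V) = map_poly (\<lambda>c. coeff c d) U * map_poly (\<lambda>c. coeff c e) V"
  by (rule poly_eqI) (simp add: coeff_map_poly coeff_mult coeff_sum coeff_mult_degree_le[OF assms, unfolded coeff_mult])

lemma inner_degree_exists:
  fixes U :: "'a::comm_ring_1 poly poly"
  assumes "U \<noteq> 0"
  shows "\<exists>d. (\<forall>i. degree (coeff U i) \<le> d) \<and> map_poly (\<lambda>c. coeff c d) U \<noteq> 0"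
proof -
  define D where "D = (\<lambda>i. degree (coeff U i)) ` {i. coeff U i \<noteq> 0}"
  have "{i. coeff U i \<noteq> 0} \<subseteq> {..degree U}" by (auto intro: le_degree)
  then have fin: "finite D" unfolding D_def by (auto intro: finite_subset)
  have "coeff U (degree U) \<noteq> 0" using assms by simp
  then have ne: "D \<noteq> {}" unfolding D_def by blast
  have "degree (coeff U i) \<le> Max D" for i
    using fin by (cases "coeff U i = 0") (auto simp: D_def intro!: Max_ge)
  moreover from Max_in[OF fin ne] obtain i where "coeff U i \<noteq> 0" "degree (coeff U i) = Max D"
    by (auto simp: D_def)
  then have "coeff (map_poly (\<lambda>c. coeff c (Max D)) U) i \<noteq> 0"
    by (auto simp: coeff_map_poly simp flip: leading_coeff_0_iff)
  then have "map_poly (\<lambda>c. coeff c (Max D)) U \<noteq> 0" by (metis coeff_0)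
  ultimately show ?thesis by blast
qed

lemma map_coeff_const_mult:
  fixes V :: "'a::comm_ring_1 poly poly"
  shows "map_poly (\<lambda>c. coeff c j) (map_poly (\<lambda>c. [:c:]) u * V) = u * map_poly (\<lambda>c. coeff c j) V"
  by (rule poly_eqI) (simp add: coeff_map_poly coeff_mult coeff_sum)

lemma inner_degree_0_imp_const:
  fixes U :: "'a::comm_ring_1 poly poly"
  assumes "\<And>i. degree (coeff U i) = 0"
  shows "U = map_poly (\<lambda>c. [:c:]) (map_poly (\<lambda>c. coeff c 0) U)"
  using assms by (intro poly_eqI) (auto simp: coeff_map_poly coeff_pCons split: nat.splits intro: coeff_eq_0)

text \<open>Over a domain the inner degree is additive. If the product has no larger inner degree
  than one coefficient of \<open>V\<close>, nothing is left for \<open>U\<close>.\<close>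

lemma inner_const_factor:
  fixes U V :: "'a::idom poly poly"
  assumes nz: "U \<noteq> 0" "V \<noteq> 0"
    and deg: "\<And>i. degree (coeff (U * V) i) \<le> degree (coeff V k)"
  shows "U = map_poly (\<lambda>c. [:c:]) (map_poly (\<lambda>c. coeff c 0) U)"
proof -
  obtain d where d: "\<And>i. degree (coeff U i) \<le> d" "map_poly (\<lambda>c. coeff c d) U \<noteq> 0"
    using inner_degree_exists[OF nz(1)] by blast
  obtain e where e: "\<And>i. degree (coeff V i) \<le> e" "map_poly (\<lambda>c. coeff c e) V \<noteq> 0"
    using inner_degree_exists[OF nz(2)] by blast
  have "map_poly (\<lambda>c. coeff c (d + e)) (U * V) \<noteq> 0"
    unfolding map_coeff_mult[OF d(1) e(1)] using d e by simp
  then obtain i where "coeff (map_poly (\<lambda>c. coeff c (d + e)) (U * V)) i \<noteq> 0"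
    by (auto simp: poly_eq_iff)
  then have "coeff (coeff (U * V) i) (d + e) \<noteq> 0" by (simp add: coeff_map_poly)
  then have "d + e \<le> degree (coeff (U * V) i)" by (rule le_degree)
  with deg[of i] e(1)[of k] have "d = 0" by linarith
  with d(1) show ?thesis by (intro inner_degree_0_imp_const) auto
qed

text \<open>The polynomial g(x) g(y) + (g(x) - g(y)) / (x - y), whose zeros are the pairs of distinct points
  at which x - 1 / g(x) takes the same value.\<close>

definition pair_poly :: "int poly \<Rightarrow> int poly poly" where
  "pair_poly g = smult g (map_poly (\<lambda>c. [:c:]) g) + synthetic_div (map_poly (\<lambda>c. [:c:]) g) [:0, 1:]"

lemma poly_const_X: "poly (map_poly (\<lambda>c. [:c:]) g) [:0, 1:] = (g :: int poly)"
proof -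
  interpret type_hom "\<lambda>c::int. [:c:]" by unfold_locales (rule hom_on_const_poly)
  show ?thesis by (induction g) auto
qed

text \<open>Division of g(x) by x - y gives (g(x) - g(y)) / (x - y). Since (x^k - y^k) / (x - y) is
  the sum of all x^i y^j with i + j = k - 1, the index shifts by one.\<close>

lemma coeff_synthetic_div_X:
  "coeff (coeff (synthetic_div (map_poly (\<lambda>c. [:c:]) g) [:0, 1:]) i) j = coeff (g :: int poly) (i + j + 1)"
proof -
  interpret type_hom "\<lambda>c::int. [:c:]" by unfold_locales (rule hom_on_const_poly)
  show ?thesis
    by (induction g arbitrary: i) (auto simp: poly_const_X[unfolded one_pCons[symmetric]] coeff_pCons split: nat.splits)
qed

lemma coeff_pair_poly: "coeff (coeff (pair_poly g) i) j = coeff g i * coeff g j + coeff g (i + j + 1)"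
  by (simp add: pair_poly_def coeff_synthetic_div_X coeff_map_poly mult.commute del: One_nat_def)

definition eval2 :: "'a::comm_ring_1 \<Rightarrow> 'a \<Rightarrow> int poly poly \<Rightarrow> 'a" where
  "eval2 x y A = poly (map_poly (\<lambda>c. poly (map_poly of_int c) y) A) x"

lemma hom_on_eval2: "hom_on UNIV (eval2 x y)"
  unfolding eval2_def
  by (intro type_hom.eval_hom type_hom.intro hom_on_of_int)

text \<open>Eliminating \<open>s\<close> from the two equations gives g(x) - g(y) = - (x - y) g(x)
  g(y); the factor x - y is then cancelled.\<close>

lemma eval2_pair_poly:
  fixes x y :: "'a::idom"
  assumes "x \<noteq> y" "poly (map_poly of_int g) x * (x - s) = 1" "poly (map_poly of_int g) y * (y - s) = 1"
  shows "eval2 x y (pair_poly g) = 0"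
proof -
  let ?g = "map_poly of_int g :: 'a poly" and ?G = "map_poly (\<lambda>c. [:c:]) g"
  interpret ev: type_hom "eval2 x y" by unfold_locales (rule hom_on_eval2)
  interpret iy: type_hom "\<lambda>c. poly (map_poly of_int c) y"
    by unfold_locales (intro type_hom.eval_hom type_hom.intro hom_on_of_int)
  interpret of_int: type_hom "of_int :: int \<Rightarrow> 'a" by unfold_locales (rule hom_on_of_int)
  interpret c: type_hom "\<lambda>c. [:c:] :: int poly" by unfold_locales (rule hom_on_const_poly)
  have const: "eval2 x y [:c:] = poly (map_poly of_int c) y" for c
    by (simp add: eval2_def)
  have G: "eval2 x y ?G = poly ?g x"
    unfolding eval2_def by (induction g) auto
  have lin: "eval2 x y [:- [:0, 1:], 1:] = x - y"
    unfolding eval2_def iy.map_hom_pCons iy.hom_uminus by simp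
  have "[:- [:0, 1:], 1:] * synthetic_div ?G [:0, 1:] + [:g:] = ?G"
    using synthetic_div_correct'[of "[:0, 1:]" ?G] by (simp only: poly_const_X)
  then have "eval2 x y [:- [:0, 1:], 1:] * eval2 x y (synthetic_div ?G [:0, 1:]) + poly ?g y = poly ?g x"
    by (metis ev.hom_add ev.hom_mult const G)
  then have 1: "(x - y) * eval2 x y (synthetic_div ?G [:0, 1:]) = poly ?g x - poly ?g y"
    by (simp only: lin) (simp add: algebra_simps)
  have "eval2 x y (pair_poly g) = poly ?g x * poly ?g y + eval2 x y (synthetic_div ?G [:0, 1:])"
    unfolding pair_poly_def ev.hom_add using ev.hom_mult[of "[:g:]" ?G] by (simp add: const G mult.commute)
  then have "(x - y) * eval2 x y (pair_poly g) = (x - y) * (poly ?g x * poly ?g y) + (poly ?g x - poly ?g y)"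
    by (simp only: distrib_left 1)
  also have "\<dots> = 0"
  proof -
    have "(x - y) * (A * B) + (A - B) = 0" if "A * (x - s) = 1" "B * (y - s) = 1" for A B :: 'a
    proof -
      have "A - B = A * (B * (y - s)) - B * (A * (x - s))" using that by simp
      also have "\<dots> = - ((x - y) * (A * B))" by (simp add: algebra_simps)
      finally show ?thesis by simp
    qed
    then show ?thesis using assms(2,3) by simp
  qed
  finally show ?thesis using assms(1) by simp
qed

lemma dvd_poly_0_if_root:
  fixes p :: "int poly"
  assumes "poly p a = 0" "d dvd a"
  shows "d dvd poly p 0"
proof -
  obtain q where "p = [:-a, 1:] * q" using assms(1) by (auto simp: poly_eq_0_iff_dvd elim: dvdE)
  then show ?thesis using assms(2) by auto
qed

text \<open>When the leading coefficient of \<open>U\<close> in x is constant, that of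
  \<open>V\<close> already has the full y-degree N, so \<open>U\<close> is a polynomial u(x). It
  divides every coefficient with respect to y. Those of y^N and y^(N-1) are g and c g + 1, which
  forces u to be a unit.\<close>

lemma pair_poly_const_factor:
  fixes g :: "int poly"
  assumes g: "lead_coeff g = 1" "degree g > 0"
    and UV: "pair_poly g = U * V" and U: "degree (lead_coeff U) = 0"
  shows "U dvd 1"
proof -
  define N where "N = degree g"
  have gN: "coeff g N = 1" using g by (simp add: N_def)
  have gbig: "coeff g i = 0" if "i > N" for i using that by (simp add: N_def coeff_eq_0)
  have lc: "coeff (pair_poly g) N = g"
    by (rule poly_eqI) (simp add: coeff_pair_poly gN gbig)
  have big: "coeff (pair_poly g) i = 0" if "i > N" for i
    using that by (intro poly_eqI) (simp add: coeff_pair_poly gbig)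
  have "degree (pair_poly g) = N"
    using big lc g by (intro antisym degree_le le_degree) auto
  then have lead: "lead_coeff U * lead_coeff V = g"
    using lc UV lead_coeff_mult[of U V] by simp
  then have nz: "U \<noteq> 0" "V \<noteq> 0" using g by auto
  have "degree (lead_coeff V) = N"
    using lead nz degree_mult_eq[of "lead_coeff U" "lead_coeff V"] U by (simp add: N_def)
  define u where "u = map_poly (\<lambda>c. coeff c 0) U"
  have Uu: "U = map_poly (\<lambda>c. [:c:]) u"
    unfolding u_def
  proof (rule inner_const_factor[OF nz])
    show "degree (coeff (U * V) i) \<le> degree (coeff V (degree V))" for i
      unfolding UV[symmetric] \<open>degree (lead_coeff V) = N\<close>
      by (intro degree_le) (simp add: coeff_pair_poly gbig)
  qed
  have u: "u dvd map_poly (\<lambda>c. coeff c j) (pair_poly g)" for j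
    unfolding UV by (subst Uu) (simp add: map_coeff_const_mult)
  have "map_poly (\<lambda>c. coeff c N) (pair_poly g) = g"
    by (rule poly_eqI) (simp add: coeff_map_poly coeff_pair_poly gN gbig)
  with u[of N] have "u dvd g" by simp
  have "map_poly (\<lambda>c. coeff c (N - 1)) (pair_poly g) = smult (coeff g (N - 1)) g + 1"
  proof (rule poly_eqI)
    fix i show "coeff (map_poly (\<lambda>c. coeff c (N - 1)) (pair_poly g)) i = coeff (smult (coeff g (N - 1)) g + 1) i"
      using g gN gbig[of "i + N"] by (cases "i = 0") (auto simp: coeff_map_poly coeff_pair_poly N_def)
  qed
  with u[of "N - 1"] have "u dvd smult (coeff g (N - 1)) g + 1" by simp
  with \<open>u dvd g\<close> have "u dvd 1" by (metis dvd_add_right_iff dvd_smult)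
  then obtain v where "1 = u * v" by (elim dvdE)
  interpret c: type_hom "map_poly (\<lambda>c. [:c:] :: int poly)"
    by unfold_locales (intro type_hom.map_hom type_hom.intro hom_on_const_poly)
  have "1 = U * map_poly (\<lambda>c. [:c:]) v"
    unfolding Uu c.hom_mult[symmetric] \<open>1 = u * v\<close>[symmetric] by simp
  then show ?thesis by (metis dvd_triv_left)
qed

text \<open>The coefficients of x^N and x^(N-1), where N is the degree of g, are g(y) and 1 + c g(y).
  If both factors had leading coefficient divisible by d at y = 0, then d would divide the latter at y = 0.\<close>

lemma irreducible_pair_poly:
  fixes S :: "int set"
  assumes S: "finite S" "S \<noteq> {}" "\<And>a. a \<in> S \<Longrightarrow> d dvd a" "\<not> d dvd 1"
    and g: "g = (\<Prod>a\<in>S. [:-a, 1:])"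
  shows "irreducible (pair_poly g)"
proof (rule irreducibleI)
  define N where "N = degree g"
  have lg: "lead_coeff g = 1" unfolding g lead_coeff_prod by simp
  have "degree g = card S" unfolding g by (subst degree_prod_eq_sum_degree) auto
  then have N: "N > 0" using S by (simp add: N_def card_gt_0_iff)
  have gN: "coeff g N = 1" using lg by (simp add: N_def)
  have gbig: "coeff g i = 0" if "i > N" for i using that by (simp add: N_def coeff_eq_0)
  have lc: "coeff (pair_poly g) N = g"
    by (rule poly_eqI) (simp add: coeff_pair_poly gN gbig)
  have big: "coeff (pair_poly g) i = 0" if "i > N" for i
    using that by (intro poly_eqI) (simp add: coeff_pair_poly gbig)
  have degP: "degree (pair_poly g) = N"
    using big lc lg by (intro antisym degree_le le_degree) auto
  show "pair_poly g \<noteq> 0" using degP N by auto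
  show "\<not> pair_poly g dvd 1"
    using degP N by (auto simp: is_unit_poly_iff)
  fix U V assume UV: "pair_poly g = U * V"
  have lead: "lead_coeff U * lead_coeff V = g"
    using lc degP UV lead_coeff_mult[of U V] by simp
  have UV0: "U \<noteq> 0" "V \<noteq> 0" using lead lg by auto
  have degUV: "degree U + degree V = N" using degP UV UV0 by (simp add: degree_mult_eq)
  \<comment> \<open>A nonconstant divisor of \<open>g\<close> vanishes at some \<open>a\<close> in
    \<open>S\<close>; modulo \<open>d\<close> this zero is 0.\<close>
  have dvd0: "d dvd coeff w 0" if w: "w dvd g" "degree w > 0" for w
  proof -
    obtain a where "a \<in> S" "poly w a = 0"
      using dvd_prod_linear_imp_root[of S w] w S(1) by (auto simp: g)
    then show ?thesis using dvd_poly_0_if_root[of w a d] S(3) by (simp add: poly_0_coeff_0)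
  qed
  have "degree (lead_coeff U) = 0 \<or> degree (lead_coeff V) = 0"
  proof (rule ccontr)
    assume "\<not> ?thesis"
    then have dU: "d dvd coeff (lead_coeff U) 0" and dV: "d dvd coeff (lead_coeff V) 0"
      using dvd0 lead by (metis dvd_triv_left dvd_triv_right gr0I)+
    have "coeff (coeff (U * V) (N - 1)) 0 = (\<Sum>k\<le>N - 1. coeff (coeff U k) 0 * coeff (coeff V (N - 1 - k)) 0)"
      by (simp add: coeff_mult coeff_sum)
    also have "d dvd \<dots>"
    proof (rule dvd_sum)
      fix k assume "k \<in> {..N - 1}"
      \<comment> \<open>The degrees add up to N and the indices only to N - 1, so at most one index
        lies below the degree of its factor. Each term is therefore 0 or contains a leading
        coefficient divisible by \<open>d\<close>.\<close>
      consider "k > degree U" | "k = degree U" | "N - 1 - k = degree V" | "N - 1 - k > degree V"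
        using degUV by linarith
      then show "d dvd coeff (coeff U k) 0 * coeff (coeff V (N - 1 - k)) 0"
        using dU dV by cases (auto simp: coeff_eq_0)
    qed
    finally have "d dvd coeff g (N - 1) * coeff g 0 + 1"
      using N gN unfolding UV[symmetric] coeff_pair_poly by simp
    moreover have "d dvd coeff g 0" using dvd0[of g] N by (simp add: N_def)
    ultimately have "d dvd 1" by (metis dvd_add_right_iff dvd_mult)
    with S(4) show False by simp
  qed
  then show "U dvd 1 \<or> V dvd 1"
    using pair_poly_const_factor[OF lg _ UV] pair_poly_const_factor[of g V U] lg N UV
    by (auto simp: N_def mult.commute)
qed

lemma prime_elem_pair_poly:
  assumes "finite S" "S \<noteq> {}" "\<And>a. a \<in> S \<Longrightarrow> d dvd a" "\<not> d dvd 1"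
  shows "prime_elem (pair_poly (\<Prod>a\<in>S. [:-a, 1:]))"
  by (intro irreducible_imp_prime_elem irreducible_pair_poly[OF assms]) auto

text \<open>Stated with integer coefficients, this is injectivity of evaluation at \<open>s\<close>,
  the form in which \<open>prime_elem_dvd_if_root\<close> uses it. In the fields of characteristic 0
  considered here it means transcendence over Q.\<close>

definition transcendental_int :: "'a::comm_ring_1 \<Rightarrow> bool" where
  "transcendental_int s \<longleftrightarrow> (\<forall>c::int poly. poly (map_poly of_int c) s = 0 \<longrightarrow> c = 0)"

section \<open>Kernels of evaluation at a root and at a pair of roots\<close>

lemma ex_prime_factor_kernel:
  fixes f :: "'a::factorial_semiring" and e :: "'a \<Rightarrow> 'b::idom"
  assumes "e 1 = 1" "\<And>x y. e (x * y) = e x * e y" "f \<noteq> 0" "e f = 0"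
  shows "\<exists>p. prime_elem p \<and> p dvd f \<and> e p = 0"
  using assms(3,4)
proof (induction f rule: prime_divisors_induct)
  case zero
  then show ?case by simp
next
  case (unit x)
  then obtain y where "1 = x * y" by (elim dvdE)
  then have "e x * e y = 1" by (metis assms(1,2))
  with unit show ?case by simp
next
  case (factor p x)
  then have "e p = 0 \<or> e x = 0" by (simp add: assms(2))
  with factor show ?case by (metis dvd_mult dvd_triv_left mult_zero_right prime_imp_prime_elem)
qed

text \<open>A common factor of f(s, x) = g(x) (x - s) - 1 and of a polynomial in x alone has degree 0 in s,
  so it divides both coefficients - g and x g - 1 of f with respect to s.\<close>

lemma transcendental_root:
  fixes s \<alpha> :: "'b::idom"
  assumes s: "transcendental_int s" and \<alpha>: "poly (map_poly of_int g) \<alpha> * (\<alpha> - s) = 1"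
  shows "transcendental_int \<alpha>"
proof (rule ccontr)
  assume "\<not> ?thesis"
  then obtain c :: "int poly" where c: "c \<noteq> 0" "poly (map_poly of_int c) \<alpha> = 0"
    by (auto simp: transcendental_int_def)
  define h where "h = (\<lambda>c. poly (map_poly of_int c) s)"
  have h: "hom_on UNIV h" unfolding h_def by (intro type_hom.eval_hom type_hom.intro hom_on_of_int)
  interpret h: type_hom h by unfold_locales (rule h)
  interpret of_int: type_hom "of_int :: int \<Rightarrow> 'b" by unfold_locales (rule hom_on_of_int)
  have inj: "x = 0" if "h x = 0" for x using s that by (simp add: transcendental_int_def h_def)
  define e where "e = (\<lambda>p. poly (map_poly h p) \<alpha>)"
  interpret e: type_hom e unfolding e_def by unfold_locales (rule h.eval_hom)
  have lift: "e (map_poly (\<lambda>c. [:c:]) p) = poly (map_poly of_int p) \<alpha>" for p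
  proof -
    interpret type_hom "\<lambda>c::int. [:c:]" by unfold_locales (rule hom_on_const_poly)
    have "h [:a:] = of_int a" for a by (simp add: h_def)
    then show ?thesis by (induction p) (auto simp: e_def)
  qed
  define G :: "int poly poly" where "G = map_poly (\<lambda>c. [:c:]) g"
  \<comment> \<open>The equation with x as outer and the parameter s as inner variable.\<close>
  define f where "f = G * [:- [:0, 1:], 1:] - 1"
  have "e [:- [:0, 1:], 1:] = \<alpha> - s"
    unfolding e_def h.map_hom_pCons h.hom_uminus by (simp add: h_def)
  then have "e f = poly (map_poly of_int g) \<alpha> * (\<alpha> - s) - 1"
    by (simp only: f_def e.hom_diff e.hom_mult e.hom_1 G_def lift)
  with \<alpha> have "e f = 0" by simp
  have f0: "map_poly (\<lambda>c. coeff c 0) f = pCons 0 g - 1"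
  proof -
    have "map_poly (\<lambda>c. coeff c 0) f = map_poly (\<lambda>c. coeff c 0) (G * [:- [:0, 1:], 1:]) - 1"
      unfolding f_def by (intro poly_eqI) (simp add: coeff_map_poly coeff_1)
    also have "map_poly (\<lambda>c. coeff c 0) (G * [:- [:0, 1:], 1:]) = g * [:0, 1:]"
      unfolding G_def map_coeff_const_mult by (intro arg_cong2[of _ _ _ _ times] refl poly_eqI) (auto simp: coeff_map_poly coeff_pCons split: nat.splits)
    finally show ?thesis by simp
  qed
  have f1: "map_poly (\<lambda>c. coeff c 1) f = - g"
  proof -
    have "map_poly (\<lambda>c. coeff c 1) f = map_poly (\<lambda>c. coeff c 1) (G * [:- [:0, 1:], 1:])"
      unfolding f_def by (intro poly_eqI) (simp add: coeff_map_poly coeff_1)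
    also have "\<dots> = g * [:-1:]"
      unfolding G_def map_coeff_const_mult by (intro arg_cong2[of _ _ _ _ times] refl poly_eqI) (auto simp: coeff_map_poly coeff_pCons split: nat.splits)
    finally show ?thesis by simp
  qed
  have "f \<noteq> 0"
  proof
    assume "f = 0"
    with f1 have "g = 0" by simp
    with \<alpha> show False by simp
  qed
  obtain p where p: "prime_elem p" "p dvd f" "e p = 0"
    using ex_prime_factor_kernel[of e f] e.hom_mult \<open>f \<noteq> 0\<close> \<open>e f = 0\<close> by auto
  define C :: "int poly poly" where "C = map_poly (\<lambda>c. [:c:]) c"
  have "coeff (coeff C n) 0 = coeff c n" for n by (simp add: C_def coeff_map_poly)
  then have "C \<noteq> 0" using c(1) by (metis coeff_0 poly_eqI)
  \<comment> \<open>\<open>C\<close> is free of the inner variable, and so is its divisor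
    \<open>p\<close>.\<close>
  have "p dvd C"
    using prime_elem_dvd_if_root[OF h inj p(1), of \<alpha> C] p(3) lift[of c] c(2) by (simp add: e_def C_def)
  then obtain V where V: "C = p * V" by (elim dvdE)
  have pV: "p \<noteq> 0" "V \<noteq> 0" using \<open>C \<noteq> 0\<close> V by auto
  define u where "u = map_poly (\<lambda>c. coeff c 0) p"
  have pu: "p = map_poly (\<lambda>c. [:c:]) u"
    unfolding u_def
    by (rule inner_const_factor[OF pV]) (simp add: V[symmetric] C_def coeff_map_poly)
  obtain W where W: "f = p * W" using p(2) by (elim dvdE)
  have u: "u dvd map_poly (\<lambda>c. coeff c j) f" for j
    unfolding W by (subst pu) (simp add: map_coeff_const_mult)
  have "u dvd g" using u[of 1] unfolding f1 by simp
  moreover have "u dvd [:0, 1:] * g - 1" using u[of 0] unfolding f0 by simp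
  ultimately have "u dvd 1" by (metis dvd_diff_right_iff dvd_mult)
  then obtain v where "1 = u * v" by (elim dvdE)
  interpret c: type_hom "map_poly (\<lambda>c. [:c:] :: int poly)"
    by unfold_locales (intro type_hom.map_hom type_hom.intro hom_on_const_poly)
  have "1 = p * map_poly (\<lambda>c. [:c:]) v"
    unfolding pu c.hom_mult[symmetric] \<open>1 = u * v\<close>[symmetric] by simp
  then have "p dvd 1" by (metis dvd_triv_left)
  with p(1) show False by (simp add: prime_elem_def)
qed

text \<open>A root \<open>y\<close> of the equation is transcendental along with \<open>s\<close>,
  so specializing the inner variable to \<open>y\<close> is injective. The prime
  \<open>pair_poly g\<close> then divides everything that vanishes at the pair.\<close>

lemma pair_poly_dvd:
  fixes x y s :: "'a::idom" and S :: "int set"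
  assumes S: "finite S" "S \<noteq> {}" "\<And>a. a \<in> S \<Longrightarrow> d dvd a" "\<not> d dvd 1"
    and g: "g = (\<Prod>a\<in>S. [:-a, 1:])"
    and s: "transcendental_int s" "x \<noteq> y"
      "poly (map_poly of_int g) x * (x - s) = 1" "poly (map_poly of_int g) y * (y - s) = 1"
    and A: "eval2 x y A = 0"
  shows "pair_poly g dvd A"
proof (rule prime_elem_dvd_if_root)
  show "prime_elem (pair_poly g)" unfolding g by (rule prime_elem_pair_poly[OF S])
  show "hom_on UNIV (\<lambda>c. poly (map_poly of_int c) y)"
    by (intro type_hom.eval_hom type_hom.intro hom_on_of_int)
  show "c = 0" if "poly (map_poly of_int c) y = 0" for c :: "int poly"
    using transcendental_root[OF s(1,4)] that by (simp add: transcendental_int_def)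
qed (use A eval2_pair_poly[OF s(2-4)] in \<open>simp_all add: eval2_def\<close>)

text \<open>Both kernels are the multiples of the same \<open>pair_poly g\<close>. This is double
  transitivity in the form used later, and it compares pairs living in different rings.\<close>

lemma eval2_eq_0_iff:
  fixes x y s :: "'a::idom" and x' y' s' :: "'b::idom" and S :: "int set"
  assumes S: "finite S" "S \<noteq> {}" "\<And>a. a \<in> S \<Longrightarrow> d dvd a" "\<not> d dvd 1"
    and g: "g = (\<Prod>a\<in>S. [:-a, 1:])"
    and s: "transcendental_int s" "x \<noteq> y"
      "poly (map_poly of_int g) x * (x - s) = 1" "poly (map_poly of_int g) y * (y - s) = 1"
    and s': "transcendental_int s'" "x' \<noteq> y'"
      "poly (map_poly of_int g) x' * (x' - s') = 1" "poly (map_poly of_int g) y' * (y' - s') = 1"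
  shows "eval2 x y A = 0 \<longleftrightarrow> eval2 x' y' A = 0"
proof -
  interpret e: type_hom "eval2 x y" by unfold_locales (rule hom_on_eval2)
  interpret e': type_hom "eval2 x' y'" by unfold_locales (rule hom_on_eval2)
  have "eval2 x y A = 0 \<longleftrightarrow> pair_poly g dvd A"
    using pair_poly_dvd[OF S g s] eval2_pair_poly[OF s(2-4)] by (auto simp: e.hom_mult elim!: dvdE)
  moreover have "eval2 x' y' A = 0 \<longleftrightarrow> pair_poly g dvd A"
    using pair_poly_dvd[OF S g s'] eval2_pair_poly[OF s'(2-4)] by (auto simp: e'.hom_mult elim!: dvdE)
  ultimately show ?thesis by simp
qed
subsection \<open>Roots over complex Laurent series\<close>

lemma ex_fps_nth_root:
  fixes h :: "complex fps"
  assumes "k > 0" "h $ 0 \<noteq> 0"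
  shows "\<exists>y. y ^ k = h"
proof -
  obtain z where "z ^ k = h $ 0" using nth_root_exists[OF assms(1)] by blast
  obtain k' where k: "k = Suc k'" using assms(1) gr0_implies_Suc by blast
  have "fps_radical (\<lambda>_ _. z) (Suc k') h ^ Suc k' = h"
    using power_radical[of h "\<lambda>_ _. z" k'] assms(2) \<open>z ^ k = h $ 0\<close> by (simp add: k)
  then show ?thesis unfolding k by blast
qed

lemma fps_of_pcompose_shift:
  fixes p :: "'a::field poly"
  assumes "W $ 0 = 0"
  shows "fps_of_poly (pcompose p [:r, 1:]) oo W = poly (map_poly fps_const p) (fps_const r + W)"
proof (induction p)
  case (pCons a p)
  have "fps_of_poly [:r, 1:] oo W = fps_const r + W"
    using assms by (simp add: fps_of_poly_pCons fps_compose_add_distrib fps_X_fps_compose_startby0)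
  then have "fps_of_poly (pcompose (pCons a p) [:r, 1:]) oo W =
      fps_const a + (fps_const r + W) * (fps_of_poly (pcompose p [:r, 1:]) oo W)"
    by (simp only: pcompose_pCons fps_of_poly_add fps_of_poly_mult fps_of_poly_const
        fps_compose_add_distrib fps_compose_mult_distrib[OF assms] fps_const_compose)
  with pCons show ?case by (simp add: map_poly_pCons)
qed simp

text \<open>Near a zero r of order k of f(sc, x), the equation f(sc + Y^k, x) = 0 reads A^k = Y^k for a local
  coordinate A at r, and is solved by inverting A.\<close>

lemma ex_puiseux_branch:
  fixes G h1 :: "complex poly"
  assumes "k > 0" and fac: "G * [:-sc, 1:] - 1 = [:-r, 1:] ^ k * h1" and h1: "poly h1 r \<noteq> 0"
  shows "\<exists>B. B $ 0 = 0 \<and> B $ 1 \<noteq> 0 \<and> (\<forall>Y. Y $ 0 = 0 \<longrightarrow>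
           poly (map_poly fps_const G) (fps_const r + (B oo Y)) *
             (fps_const r + (B oo Y) - (fps_const sc + Y ^ k)) = 1)"
proof -
  define D where "D = fps_of_poly (pcompose G [:r, 1:])"
  define N1 where "N1 = fps_of_poly (pcompose h1 [:r, 1:])"
  have sh: "pcompose ([:-r, 1:] ^ k) [:r, 1:] = [:0, 1:] ^ k"
  proof -
    have "pcompose [:-r, 1:] [:r, 1:] = [:0, 1:]" by (simp add: pcompose_pCons)
    then show ?thesis by (induction k) (simp_all only: power_0 power_Suc pcompose_1 pcompose_mult)
  qed
  have "poly (G * [:-sc, 1:] - 1) r = 0" unfolding fac using assms(1) by simp
  then have Gr: "poly G r \<noteq> 0" by auto
  have D0: "D $ 0 \<noteq> 0" using Gr by (simp add: D_def poly_pcompose flip: poly_0_coeff_0)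
  have N0: "N1 $ 0 \<noteq> 0" using h1 by (simp add: N1_def poly_pcompose flip: poly_0_coeff_0)
  \<comment> \<open>The equation to be solved is x - sc - 1 / G(x) = Y^k. At x = r + X its left side
    is X^k \<open>h\<close>, and a k-th root of \<open>h\<close> turns it into a k-th power A^k. The
    division is legitimate because G(r) (r - sc) = 1.\<close>
  define h where "h = N1 * inverse D"
  have h0: "h $ 0 \<noteq> 0" using D0 N0 by (simp add: h_def)
  have hD: "h * D = N1" unfolding h_def using D0 by (simp add: mult.assoc inverse_mult_eq_1)
  obtain y where y: "y ^ k = h" using ex_fps_nth_root[OF assms(1) h0] by blast
  have y0: "y $ 0 \<noteq> 0" using y h0 assms(1) by (metis fps_power_zeroth power_eq_0_iff)
  define A where "A = fps_X * y"
  have A: "A $ 0 = 0" "A $ 1 \<noteq> 0" using y0 by (auto simp: A_def)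
  define B where "B = fps_inv A"
  have B0: "B $ 0 = 0" by (simp add: B_def fps_inv_def)
  have AB: "A oo B = fps_X" unfolding B_def using A by (intro fps_inv_right) auto
  have B1: "B $ 1 \<noteq> 0"
  proof -
    have "(A oo B) $ 1 = A $ 1 * B $ 1" using A B0 by (simp add: fps_compose_nth)
    with AB show ?thesis by auto
  qed
  have N: "fps_of_poly (pcompose (G * [:-sc, 1:] - 1) [:r, 1:]) = A ^ k * D"
  proof -
    have "fps_of_poly (pcompose (G * [:-sc, 1:] - 1) [:r, 1:]) = fps_X ^ k * N1"
      unfolding fac pcompose_mult sh
      by (simp add: fps_of_poly_mult fps_of_poly_power fps_of_poly_pCons N1_def)
    also have "\<dots> = A ^ k * D" by (simp add: A_def power_mult_distrib y mult.assoc hD)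
    finally show ?thesis .
  qed
  have "poly (map_poly fps_const G) (fps_const r + (B oo Y)) *
             (fps_const r + (B oo Y) - (fps_const sc + Y ^ k)) = 1" if Y: "Y $ 0 = 0" for Y
  proof -
    define W where "W = B oo Y"
    have W0: "W $ 0 = 0" using B0 by (simp add: W_def)
    have "A oo W = (A oo B) oo Y" unfolding W_def using B0 Y by (subst fps_compose_assoc) auto
    also have "\<dots> = Y" using AB Y by (simp add: fps_X_fps_compose_startby0)
    finally have AW: "A oo W = Y" .
    have "poly (map_poly fps_const (G * [:-sc, 1:] - 1)) (fps_const r + W) = (A ^ k * D) oo W"
      using fps_of_pcompose_shift[OF W0, of "G * [:-sc, 1:] - 1" r] N by simp
    also have "\<dots> = Y ^ k * poly (map_poly fps_const G) (fps_const r + W)"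
      using W0 fps_of_pcompose_shift[OF W0, of G r]
      by (simp add: fps_compose_mult_distrib fps_compose_power[symmetric] AW D_def)
    finally have 1: "poly (map_poly fps_const (G * [:-sc, 1:] - 1)) (fps_const r + W) =
      Y ^ k * poly (map_poly fps_const G) (fps_const r + W)" .
    interpret c: type_hom "fps_const :: complex \<Rightarrow> complex fps"
      by unfold_locales (auto simp: hom_on_def)
    interpret e: type_hom "\<lambda>p. poly (map_poly fps_const p) (fps_const r + W)"
      by unfold_locales (rule c.eval_hom)
    have lin: "poly (map_poly fps_const [:-sc, 1:]) (fps_const r + W) = fps_const r + W - fps_const sc"
      by simp
    from 1 have "poly (map_poly fps_const G) (fps_const r + W) * (fps_const r + W - fps_const sc) - 1 =
        Y ^ k * poly (map_poly fps_const G) (fps_const r + W)"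
      by (simp only: e.hom_diff e.hom_mult e.hom_1 lin)
    moreover have "a * (b - (c + y)) = 1" if "a * (b - c) - 1 = y * a" for a b c y :: "complex fps"
      using that by (simp add: algebra_simps)
    ultimately show ?thesis unfolding W_def by blast
  qed
  with B0 B1 show ?thesis by blast
qed

section \<open>The reflection of Laurent series in u and the local splitting\<close>

definition fls_reflect :: "complex fls \<Rightarrow> complex fls" where
  "fls_reflect x = fls_compose_fps x (- fps_X)"

lemma hom_fls_reflect: "hom_on UNIV fls_reflect"
  by (auto simp: hom_on_def fls_reflect_def fls_compose_fps_add fls_compose_fps_mult)

lemma fls_reflect_fps: "fls_reflect (fps_to_fls f) = fps_to_fls (f oo - fps_X)"
  by (simp add: fls_reflect_def)

lemma fls_reflect_const: "fls_reflect (fls_const c) = fls_const c"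
  by (simp add: fls_reflect_def)

lemma fls_reflect_involution: "fls_reflect (fls_reflect x) = x"
proof -
  have "(- fps_X) oo (- fps_X) = (fps_X :: complex fps)"
    by (simp add: fps_compose_uminus fps_X_fps_compose_startby0)
  then have "fls_reflect (fls_reflect x) = fls_compose_fps x fps_X"
    by (simp add: fls_reflect_def fls_compose_fps_assoc)
  also have "\<dots> = x"
    using fls_nth_fls_compose_fps_linear[of 1 x] by (intro fls_eqI) simp
  finally show ?thesis .
qed

lemma poly_of_int_fps_to_fls:
  fixes f :: "'a::field fps"
  shows "poly (map_poly of_int g) (fps_to_fls f) = fps_to_fls (poly (map_poly fps_const (map_poly of_int g)) f)"
proof -
  interpret i: type_hom "of_int :: int \<Rightarrow> 'a fls" by unfold_locales (rule hom_on_of_int)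
  interpret j: type_hom "of_int :: int \<Rightarrow> 'a" by unfold_locales (rule hom_on_of_int)
  interpret c: type_hom "fps_const :: 'a \<Rightarrow> 'a fps" by unfold_locales (auto simp: hom_on_def)
  have "of_int a = fps_to_fls (fps_const (of_int a :: 'a))" for a
  proof -
    interpret t: type_hom "fls_const :: 'a \<Rightarrow> 'a fls"
      by unfold_locales (auto simp: hom_on_def fls_plus_const fls_const_mult_const)
    show ?thesis by (simp add: t.hom_of_int)
  qed
  then show ?thesis
    by (induction g) (auto simp: fls_times_fps_to_fls)
qed

lemma monic_equation:
  fixes s :: "'a::idom"
  assumes "lead_coeff g = 1" "degree g > 0"
  shows "degree (map_poly of_int g * [:-s, 1:] - 1) = Suc (degree g)"
    and "lead_coeff (map_poly of_int g * [:-s, 1:] - 1) = 1"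
proof -
  let ?G = "map_poly of_int g :: 'a poly"
  have d: "degree ?G = degree g" using assms by (intro map_poly_degree_eq) auto
  have l: "lead_coeff ?G = 1" using assms d by (simp add: coeff_map_poly)
  then have "?G \<noteq> 0" by auto
  then have d2: "degree (?G * [:-s, 1:]) = Suc (degree g)" using d by (subst degree_mult_eq) auto
  have l2: "lead_coeff (?G * [:-s, 1:]) = 1" unfolding lead_coeff_mult using l by simp
  show 1: "degree (?G * [:-s, 1:] - 1) = Suc (degree g)"
    unfolding diff_conv_add_uminus using d2 by (subst degree_add_eq_left) auto
  show "lead_coeff (?G * [:-s, 1:] - 1) = 1"
    using l2 unfolding 1 d2 coeff_diff by (simp add: coeff_1)
qed

text \<open>Composition with the nonconstant polynomial c + X^2 kills no nonzero polynomial.\<close>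

lemma transcendental_int_quadratic: "transcendental_int (fps_to_fls (fps_const (c::complex) + fps_X ^ 2))"
  unfolding transcendental_int_def
proof (intro allI impI)
  fix p :: "int poly"
  assume "poly (map_poly of_int p) (fps_to_fls (fps_const c + fps_X ^ 2)) = 0"
  then have 0: "poly (map_poly fps_const (map_poly of_int p)) (fps_const c + fps_X ^ 2) = (0 :: complex fps)"
    unfolding poly_of_int_fps_to_fls by (simp only: fps_to_fls_eq_0_iff)
  define q :: "complex poly" where "q = map_poly of_int p"
  have "fps_of_poly (pcompose q [:c, 0, 1:]) = poly (map_poly fps_const q) (fps_const c + fps_X ^ 2)"
  proof (induction q)
    case (pCons a q)
    have "fps_of_poly [:c, 0, 1:] = fps_const c + fps_X ^ 2"
      by (simp add: fps_of_poly_pCons power2_eq_square)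
    with pCons show ?case
      by (simp only: pcompose_pCons fps_of_poly_add fps_of_poly_mult fps_of_poly_const) (simp add: map_poly_pCons)
  qed simp
  with 0 have "fps_of_poly (pcompose q [:c, 0, 1:]) = 0" by (simp add: q_def)
  then have "pcompose q [:c, 0, 1:] = 0" by simp
  then have "q = 0" by (rule pcompose_eq_0) simp
  then show "p = 0" by (auto simp: q_def poly_eq_iff coeff_map_poly)
qed

text \<open>The target of all later embeddings. \<open>Z\<close> contains every solution of t^l = M
  s + 1, so its being fixed settles the image of t whichever solution is hit.\<close>

lemma local_model:
  fixes g :: "int poly" and S :: "complex set"
  assumes g: "lead_coeff g = 1" "degree g > 0"
    and S: "finite S" "xc \<notin> S"
    and fac: "map_poly of_int g * [:-sc, 1:] - 1 = [:-xc, 1:] * (\<Prod>r\<in>insert xc S. [:-r, 1:])"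
    and M: "of_int M * sc + 1 \<noteq> 0" "l > 0"
  shows "\<exists>s \<rho>0 \<rho>1 T Z. transcendental_int s \<and> \<rho>0 \<noteq> \<rho>1 \<and> fls_reflect \<rho>0 = \<rho>1 \<and> fls_reflect \<rho>1 = \<rho>0 \<and>
    finite T \<and> (\<forall>\<rho>\<in>T. fls_reflect \<rho> = \<rho>) \<and>
    map_poly of_int g * [:-s, 1:] - 1 = (\<Prod>\<rho>\<in>insert \<rho>0 (insert \<rho>1 T). [:-\<rho>, 1:]) \<and>
    finite Z \<and> (\<forall>z\<in>Z. fls_reflect z = z) \<and>
    monom 1 l - [:of_int M * s + 1:] = (\<Prod>z\<in>Z. [:-z, 1:])"
proof -
  let ?G = "map_poly of_int g :: complex poly"
  define s :: "complex fls" where "s = fps_to_fls (fps_const sc + fps_X ^ 2)"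
  have root: "poly (map_poly of_int g * [:-s, 1:] - 1) (fps_to_fls x) = 0"
    if "poly (map_poly fps_const ?G) x * (x - (fps_const sc + fps_X ^ 2)) = 1" for x
  proof -
    have "fps_to_fls (poly (map_poly fps_const ?G) x * (x - (fps_const sc + fps_X ^ 2))) = 1"
      unfolding that by simp
    then have "poly (map_poly of_int g) (fps_to_fls x) * (fps_to_fls x - s) = 1"
      by (simp only: fls_times_fps_to_fls s_def poly_of_int_fps_to_fls fps_to_fls_minus)
    then show ?thesis by (simp add: algebra_simps)
  qed
  have "\<exists>B. B $ 0 = 0 \<and> (\<forall>Y. Y $ 0 = 0 \<longrightarrow> poly (map_poly fps_const ?G) (fps_const r + (B oo Y)) *
             (fps_const r + (B oo Y) - (fps_const sc + Y ^ 1)) = 1)" if "r \<in> S" for r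
  proof -
    have "[:-xc, 1:] * (\<Prod>r\<in>insert xc S. [:-r, 1:]) = [:-xc, 1:] * ([:-r, 1:] * (\<Prod>r\<in>insert xc S - {r}. [:-r, 1:]))"
      using S that by (subst prod.remove[of _ r]) auto
    also have "\<dots> = [:-r, 1:] ^ 1 * ([:-xc, 1:] * (\<Prod>r\<in>insert xc S - {r}. [:-r, 1:]))"
      by (simp only: power_one_right mult.left_commute)
    finally have "?G * [:-sc, 1:] - 1 = [:-r, 1:] ^ 1 * ([:-xc, 1:] * (\<Prod>r\<in>insert xc S - {r}. [:-r, 1:]))"
      using fac by (rule trans[rotated])
    moreover have "poly ([:-xc, 1:] * (\<Prod>r\<in>insert xc S - {r}. [:-r, 1:])) r \<noteq> 0"
      using S that by (auto simp: poly_prod)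
    ultimately show ?thesis using ex_puiseux_branch[OF zero_less_one] by blast
  qed
  then obtain B where B: "\<And>r. r \<in> S \<Longrightarrow> B r $ 0 = 0" "\<And>r Y. r \<in> S \<Longrightarrow> Y $ 0 = 0 \<Longrightarrow>
     poly (map_poly fps_const ?G) (fps_const r + (B r oo Y)) * (fps_const r + (B r oo Y) - (fps_const sc + Y ^ 1)) = 1"
    by metis
  \<comment> \<open>At a simple root the branch is a series in s - sc, which is u^2; it is therefore
    even in u.\<close>
  define \<rho> where "\<rho> = (\<lambda>r. fps_const r + (B r oo fps_X ^ 2))"
  have \<rho>0: "\<rho> r $ 0 = r" if "r \<in> S" for r using B(1)[OF that] by (simp add: \<rho>_def)
  have X2: "fps_X ^ 2 oo - fps_X = (fps_X ^ 2 :: complex fps)"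
    by (simp add: fps_compose_power[symmetric] fps_X_fps_compose_startby0)
  have \<rho>_fixed: "fls_reflect (fps_to_fls (\<rho> r)) = fps_to_fls (\<rho> r)" for r
    unfolding fls_reflect_fps \<rho>_def fps_compose_add_distrib by (simp add: fps_compose_assoc[symmetric] X2)
  define T where "T = (\<lambda>r. fps_to_fls (\<rho> r)) ` S"
  have T: "finite T" "card T = card S"
  proof -
    have "inj_on (\<lambda>r. fps_to_fls (\<rho> r)) S"
      using \<rho>0 by (intro inj_onI) (metis fps_to_fls_eq_iff)
    then show "finite T" "card T = card S" using S by (auto simp: T_def card_image)
  qed
  have "[:-xc, 1:] * (\<Prod>r\<in>insert xc S. [:-r, 1:]) = [:-xc, 1:] ^ 2 * (\<Prod>r\<in>S. [:-r, 1:])"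
    by (simp only: power2_eq_square prod.insert[OF S] mult.assoc)
  moreover have "poly (\<Prod>r\<in>S. [:-r, 1:]) xc \<noteq> 0" using S by (auto simp: poly_prod)
  ultimately obtain C where C: "C $ 0 = 0" "C $ 1 \<noteq> 0" "\<And>Y. Y $ 0 = 0 \<Longrightarrow>
     poly (map_poly fps_const ?G) (fps_const xc + (C oo Y)) * (fps_const xc + (C oo Y) - (fps_const sc + Y ^ 2)) = 1"
    using ex_puiseux_branch[OF zero_less_numeral] fac by metis
  \<comment> \<open>At the double root the branch takes a square root of s - sc. Both u and -u
    qualify, and the nonzero linear coefficient of \<open>C\<close> keeps the two branches
    apart.\<close>
  define \<rho>0 \<rho>1 where "\<rho>0 = fps_to_fls (fps_const xc + (C oo fps_X))"
    and "\<rho>1 = fps_to_fls (fps_const xc + (C oo - fps_X))"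
  have "fls_reflect \<rho>0 = \<rho>1"
    unfolding \<rho>0_def \<rho>1_def fls_reflect_fps fps_compose_add_distrib
    by (simp add: fps_compose_assoc[symmetric] fps_X_fps_compose_startby0)
  moreover from this have "fls_reflect \<rho>1 = \<rho>0" by (metis fls_reflect_involution)
  moreover have "\<rho>0 \<noteq> \<rho>1"
  proof
    assume "\<rho>0 = \<rho>1"
    then have "C oo fps_X = C oo - fps_X" by (simp add: \<rho>0_def \<rho>1_def)
    then have "(C oo fps_X) $ 1 = (C oo - fps_X) $ 1" by simp
    then have "C $ 1 = - C $ 1" by (simp add: fps_compose_nth)
    then show False using C(2) by simp
  qed
  moreover have "\<forall>\<rho>\<in>T. fls_reflect \<rho> = \<rho>" using \<rho>_fixed by (auto simp: T_def)
  ultimately have notT: "\<rho>0 \<notin> insert \<rho>1 T" "\<rho>1 \<notin> T" by auto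
  \<comment> \<open>The double root counts twice, so \<open>S\<close> and the two branches account
    for the whole degree.\<close>
  have cardS: "Suc (degree g) = card S + 2"
  proof -
    have "Suc (degree g) = degree ([:-xc, 1:] * (\<Prod>r\<in>insert xc S. [:-r, 1:]))"
      using monic_equation(1)[OF g, of sc] fac by simp
    also have "\<dots> = 1 + degree (\<Prod>r\<in>insert xc S. [:-r, 1:])"
      by (subst degree_mult_eq) (use S(1) in \<open>auto simp del: prod.insert\<close>)
    also have "degree (\<Prod>r\<in>insert xc S. [:-r, 1:]) = card S + 1"
      using S by (subst degree_prod_eq_sum_degree) auto
    finally show ?thesis by simp
  qed
  have "map_poly of_int g * [:-s, 1:] - 1 = (\<Prod>\<rho>\<in>insert \<rho>0 (insert \<rho>1 T). [:-\<rho>, 1:])"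
  proof (rule monic_eq_prod_roots)
    show "lead_coeff (map_poly of_int g * [:-s, 1:] - 1) = 1" by (rule monic_equation(2)[OF g])
    show "degree (map_poly of_int g * [:-s, 1:] - 1) = card (insert \<rho>0 (insert \<rho>1 T))"
      using monic_equation(1)[OF g, of s] cardS T notT by simp
    fix x assume x: "x \<in> insert \<rho>0 (insert \<rho>1 T)"
    have "poly (map_poly of_int g * [:-s, 1:] - 1) \<rho>0 = 0"
      unfolding \<rho>0_def by (rule root) (use C(3)[of fps_X] in simp)
    moreover have "poly (map_poly of_int g * [:-s, 1:] - 1) \<rho>1 = 0"
      unfolding \<rho>1_def by (rule root) (use C(3)[of "- fps_X"] in simp)
    moreover have "poly (map_poly of_int g * [:-s, 1:] - 1) (fps_to_fls (\<rho> r)) = 0" if "r \<in> S" for r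
      unfolding \<rho>_def by (rule root) (use B(2)[OF that, of "fps_X ^ 2"] in simp)
    ultimately show "poly (map_poly of_int g * [:-s, 1:] - 1) x = 0"
      using x unfolding T_def by blast
  qed (use T in auto)
  moreover have "\<exists>Z. finite Z \<and> (\<forall>z\<in>Z. fls_reflect z = z) \<and> monom 1 l - [:of_int M * s + 1:] = (\<Prod>z\<in>Z. [:-z, 1:])"
  proof -
    \<comment> \<open>The l-th root is taken in the variable s - sc, possible since the constant
      term M sc + 1 is nonzero, and u^2 is substituted afterwards.\<close>
    obtain y where y: "y ^ l = fps_const (of_int M * sc + 1) + fps_const (of_int M) * fps_X"
      using ex_fps_nth_root[of l "fps_const (of_int M * sc + 1) + fps_const (of_int M) * fps_X"] M by auto
    define t where "t = fps_to_fls (y oo fps_X ^ 2)"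
    have "(y oo fps_X ^ 2) ^ l = (y ^ l) oo fps_X ^ 2" by (simp add: fps_compose_power)
    also have "\<dots> = fps_const (of_int M * sc + 1) + fps_const (of_int M) * fps_X ^ 2"
      unfolding y by (simp add: fps_compose_add_distrib fps_compose_mult_distrib fps_X_fps_compose_startby0)
    finally have "t ^ l = fps_to_fls (fps_const (of_int M * sc + 1) + fps_const (of_int M) * fps_X ^ 2)"
      by (simp add: t_def fps_to_fls_power[symmetric])
    also have "fps_const (of_int M * sc + 1) + fps_const (of_int M) * fps_X ^ 2 = of_int M * (fps_const sc + fps_X ^ 2) + 1"
      by (simp add: fps_of_int[symmetric] algebra_simps flip: fps_const_add fps_const_mult)
    also have "fps_to_fls \<dots> = of_int M * s + 1"
      by (simp add: s_def fls_times_fps_to_fls)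
    finally have tl: "t ^ l = of_int M * s + 1" .
    have "t \<noteq> 0"
    proof
      assume "t = 0"
      with tl M have "fps_to_fls (of_int M * (fps_const sc + fps_X ^ 2) + 1) = 0"
        by (simp add: s_def fls_times_fps_to_fls power_0_left)
      then have "(of_int M * (fps_const sc + fps_X ^ 2) + 1 :: complex fps) $ 0 = 0"
        by (simp only: fps_to_fls_eq_0_iff fps_zero_nth)
      then show False using M by (simp add: fps_of_int[symmetric])
    qed
    have t_fixed: "fls_reflect t = t" unfolding t_def fls_reflect_fps by (simp add: fps_compose_assoc[symmetric] X2)
    interpret reflect: type_hom fls_reflect by unfold_locales (rule hom_fls_reflect)
    \<comment> \<open>The l-th roots of unity are complex constants and \<open>t\<close> is nonzero,
      so this gives l distinct solutions.\<close>
    define Z where "Z = (\<lambda>z. fls_const z * t) ` {z. z ^ l = 1}"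
    have "inj_on (\<lambda>z. fls_const z * t) {z. z ^ l = 1}"
      using \<open>t \<noteq> 0\<close> by (intro inj_onI) (auto dest: arg_cong[of _ _ "\<lambda>f. fls_nth f 0"])
    then have Z: "finite Z" "card Z = l"
      using M(2) card_roots_unity_eq[of l] by (auto simp: Z_def card_image intro!: finite_imageI card_ge_0_finite)
    have dm: "degree (monom 1 l - [:of_int M * s + 1:]) = l"
      unfolding diff_conv_add_uminus using M(2) by (subst degree_add_eq_left) (auto simp: degree_monom_eq)
    have "monom 1 l - [:of_int M * s + 1:] = (\<Prod>z\<in>Z. [:-z, 1:])"
    proof (rule monic_eq_prod_roots)
      show "lead_coeff (monom 1 l - [:of_int M * s + 1:]) = 1"
        unfolding dm coeff_diff using M(2) by (simp add: coeff_pCons split: nat.splits)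
      show "poly (monom 1 l - [:of_int M * s + 1:]) x = 0" if "x \<in> Z" for x
        using that tl by (auto simp: Z_def poly_monom power_mult_distrib simp flip: fls_const_power)
    qed (use dm Z in auto)
    moreover have "\<forall>z\<in>Z. fls_reflect z = z" by (auto simp: Z_def reflect.hom_mult t_fixed fls_reflect_const)
    ultimately show ?thesis using Z by blast
  qed
  ultimately show ?thesis
    using \<open>fls_reflect \<rho>0 = \<rho>1\<close> \<open>fls_reflect \<rho>1 = \<rho>0\<close> \<open>\<rho>0 \<noteq> \<rho>1\<close> \<open>\<forall>\<rho>\<in>T. fls_reflect \<rho> = \<rho>\<close> T(1)
      transcendental_int_quadratic[of sc] unfolding s_def by blast
qed
subsection \<open>Real roots\<close>

definition gpoly :: "nat \<Rightarrow> int poly" where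
  "gpoly m = (\<Prod>k\<in>{1..m}. [:5 * int k, 1:])"

lemma lead_coeff_gpoly: "lead_coeff (gpoly m) = 1"
  unfolding gpoly_def lead_coeff_prod by simp

lemma degree_gpoly: "degree (gpoly m) = m"
  unfolding gpoly_def by (subst degree_prod_eq_sum_degree) auto

lemma map_gpoly: "map_poly (of_int :: int \<Rightarrow> 'a::comm_ring_1) (gpoly m) = (\<Prod>k\<in>{1..m}. [:5 * of_nat k, 1:])"
proof -
  interpret i: type_hom "of_int :: int \<Rightarrow> 'a" by unfold_locales (rule hom_on_of_int)
  interpret p: type_hom "map_poly (of_int :: int \<Rightarrow> 'a)" by unfold_locales (rule i.map_hom)
  show ?thesis by (simp add: gpoly_def p.hom_prod)
qed

definition greal :: "nat \<Rightarrow> real \<Rightarrow> real" where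
  "greal m x = (\<Prod>k\<in>{1..m}. x + 5 * real k)"

lemma poly_gpoly: "poly (map_poly of_int (gpoly m)) x = greal m x"
  by (simp add: map_gpoly poly_prod greal_def add.commute)

lemma continuous_greal: "continuous_on A (greal m)"
  unfolding greal_def by (intro continuous_intros)

lemma greal_zero: "k \<in> {1..m} \<Longrightarrow> greal m (- 5 * real k) = 0"
  unfolding greal_def by (rule prod_zero) auto

text \<open>The point is midway between the zeros -10 j and 5 - 10 j. Exactly 2 j - 1 factors are
  negative there, an odd number, and each has absolute value at least 5/2.\<close>

lemma greal_mid:
  assumes "j \<ge> 1" "2 * j \<le> m"
  shows "greal m (5 / 2 - 10 * real j) \<le> - 1"
proof -
  let ?y = "5 / 2 - 10 * real j"
  have "{1..m} = {1..2 * j - 1} \<union> {2 * j..m}" using assms by auto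
  then have "greal m ?y = (\<Prod>k\<in>{1..2 * j - 1}. ?y + 5 * real k) * (\<Prod>k\<in>{2 * j..m}. ?y + 5 * real k)"
    unfolding greal_def by (simp only:) (rule prod.union_disjoint; auto)
  also have "(\<Prod>k\<in>{1..2 * j - 1}. ?y + 5 * real k) = - (\<Prod>k\<in>{1..2 * j - 1}. - (?y + 5 * real k))"
  proof -
    have "odd (card {1..2 * j - 1})" using assms by simp
    then show ?thesis by (simp only: prod_uminus) (simp add: uminus_power_if)
  qed
  finally have 1: "greal m ?y = - ((\<Prod>k\<in>{1..2 * j - 1}. - (?y + 5 * real k)) * (\<Prod>k\<in>{2 * j..m}. ?y + 5 * real k))"
    by simp
  have "1 \<le> (\<Prod>k\<in>{1..2 * j - 1}. - (?y + 5 * real k))"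
  proof (rule prod_ge_1)
    fix k assume "k \<in> {1..2 * j - 1}"
    then have "k + 1 \<le> 2 * j" by auto
    then have "real k + 1 \<le> 2 * real j" by linarith
    then show "1 \<le> - (?y + 5 * real k)" by simp
  qed
  moreover have "1 \<le> (\<Prod>k\<in>{2 * j..m}. ?y + 5 * real k)"
  proof (rule prod_ge_1)
    fix k assume "k \<in> {2 * j..m}"
    then have "2 * real j \<le> real k" by (metis atLeastAtMost_iff of_nat_le_iff of_nat_mult of_nat_numeral)
    then show "1 \<le> ?y + 5 * real k" by simp
  qed
  ultimately have "1 * 1 \<le> (\<Prod>k\<in>{1..2 * j - 1}. - (?y + 5 * real k)) * (\<Prod>k\<in>{2 * j..m}. ?y + 5 * real k)"
    by (intro mult_mono) auto
  with 1 show ?thesis by simp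
qed

text \<open>Left of the last zero all factors are negative, and their number is odd.\<close>

lemma greal_below:
  assumes "odd m"
  shows "greal m (- 5 * real m - 3) \<le> - 1"
proof -
  let ?y = "- 5 * real m - 3"
  have "greal m ?y = - (\<Prod>k\<in>{1..m}. - (?y + 5 * real k))"
    unfolding greal_def by (simp only: prod_uminus) (use assms in \<open>simp add: uminus_power_if\<close>)
  moreover have "1 \<le> (\<Prod>k\<in>{1..m}. - (?y + 5 * real k))"
    by (rule prod_ge_1) auto
  ultimately show ?thesis by simp
qed

text \<open>Only the factor x + 5 is negative on this interval.\<close>

lemma greal_neg:
  assumes "m \<ge> 1" "-10 < x" "x < -5"
  shows "greal m x < 0"
proof -
  have "{1..m} = insert 1 {2..m}" using assms(1) by auto
  then have "greal m x = (x + 5) * (\<Prod>k\<in>{2..m}. x + 5 * real k)"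
    by (simp add: greal_def)
  moreover have "0 < (\<Prod>k\<in>{2..m}. x + 5 * real k)"
  proof (rule prod_pos)
    fix k assume "k \<in> {2..m}"
    then have "2 \<le> real k" by auto
    then show "0 < x + 5 * real k" using assms(2) by linarith
  qed
  ultimately show ?thesis using assms(3) by (simp add: mult_neg_pos)
qed

section \<open>Locating the real roots of the equation\<close>

lemma root_between:
  assumes "l < u" "(greal m l * (l - s) - 1) * (greal m u * (u - s) - 1) < 0"
  shows "\<exists>x. l < x \<and> x < u \<and> greal m x * (x - s) = 1"
proof -
  define p where "p = map_poly of_int (gpoly m) * [:-s, 1:] - 1"
  have p: "poly p x = greal m x * (x - s) - 1" for x by (simp add: p_def poly_gpoly algebra_simps)
  show ?thesis using poly_IVT[OF assms(1), of p] assms(2) by (auto simp: p)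
qed

text \<open>All but two of the m + 1 roots are found away from the gap between -10 and -5: one to
  the right of -5, two in the gap from -10 j to 5 - 10 j for each j with 2 \<le> j \<le> m div 2,
  and one to the left of -5 m if m is odd. The left side minus 1 is -1 at every zero of g and
  positive at the chosen test points.\<close>

lemma outer_roots:
  assumes m: "m \<ge> 2" and s: "-10 < s" "s < 1"
  shows "\<exists>S. finite S \<and> card S = m - 1 \<and> (\<forall>x\<in>S. greal m x * (x - s) = 1 \<and> x \<notin> {-10..-5})"
proof -
  define h where "h = m div 2"
  have z: "greal m (-5 * real k) * (-5 * real k - s) - 1 = -1" if "k \<in> {1..m}" for k
    using greal_zero[OF that] by simp
  have z5: "greal m (- 5) = 0" using greal_zero[of 1 m] m by simp
  \<comment> \<open>The test point 2 exceeds every admissible \<open>s\<close> by more than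
    1.\<close>
  have "greal m 2 \<ge> 7"
  proof -
    have "{1..m} = insert 1 {2..m}" using m by auto
    then have "greal m 2 = 7 * (\<Prod>k\<in>{2..m}. 2 + 5 * real k)" by (simp add: greal_def)
    moreover have "1 \<le> (\<Prod>k\<in>{2..m}. 2 + 5 * real k)" by (rule prod_ge_1) auto
    ultimately show ?thesis by simp
  qed
  then have "7 * 1 \<le> greal m 2 * (2 - s)" using s by (intro mult_mono) auto
  then have "\<exists>x. -5 < x \<and> x < 2 \<and> greal m x * (x - s) = 1"
    by (intro root_between) (use z5 in \<open>auto simp: mult_less_0_iff\<close>)
  then obtain t where t: "-5 < t" "greal m t * (t - s) = 1" by blast
  have mid: "greal m (5 / 2 - 10 * real j) * (5 / 2 - 10 * real j - s) - 1 > 0" if "j \<in> {2..h}" for j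
  proof -
    have "2 * j \<le> m" "2 \<le> real j" using that by (auto simp: h_def)
    then have "greal m (5 / 2 - 10 * real j) \<le> -1" "5 / 2 - 10 * real j - s \<le> - 2"
      using greal_mid[of j m] s by auto
    then have "1 * 2 \<le> (- greal m (5 / 2 - 10 * real j)) * (- (5 / 2 - 10 * real j - s))"
      by (intro mult_mono) auto
    then show ?thesis unfolding minus_mult_minus by linarith
  qed
  have "\<exists>x. -10 * real j < x \<and> x < 5 / 2 - 10 * real j \<and> greal m x * (x - s) = 1" if "j \<in> {2..h}" for j
  proof (rule root_between)
    have "-5 * real (2 * j) = -10 * real j" by simp
    moreover have "2 * j \<in> {1..m}" using that by (auto simp: h_def)
    ultimately have eq: "greal m (-10 * real j) * (-10 * real j - s) - 1 = -1" using z by metis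
    show "(greal m (-10 * real j) * (-10 * real j - s) - 1) *
        (greal m (5 / 2 - 10 * real j) * (5 / 2 - 10 * real j - s) - 1) < 0"
      unfolding eq mult_minus1 neg_less_0_iff_less by (rule mid[OF that])
  qed simp
  then obtain a where a: "\<And>j. j \<in> {2..h} \<Longrightarrow> -10 * real j < a j \<and> a j < 5 / 2 - 10 * real j \<and> greal m (a j) * (a j - s) = 1"
    by metis
  have "\<exists>x. 5 / 2 - 10 * real j < x \<and> x < 5 - 10 * real j \<and> greal m x * (x - s) = 1" if "j \<in> {2..h}" for j
  proof (rule root_between)
    have "-5 * real (2 * j - 1) = 5 - 10 * real j" using that by (simp add: of_nat_diff)
    moreover have "2 * j - 1 \<in> {1..m}" using that by (auto simp: h_def)
    ultimately have eq: "greal m (5 - 10 * real j) * (5 - 10 * real j - s) - 1 = -1" using z by metis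
    show "(greal m (5 / 2 - 10 * real j) * (5 / 2 - 10 * real j - s) - 1) *
        (greal m (5 - 10 * real j) * (5 - 10 * real j - s) - 1) < 0"
      unfolding eq mult_minus1_right neg_less_0_iff_less by (rule mid[OF that])
  qed simp
  then obtain b where b: "\<And>j. j \<in> {2..h} \<Longrightarrow> 5 / 2 - 10 * real j < b j \<and> b j < 5 - 10 * real j \<and> greal m (b j) * (b j - s) = 1"
    by metis
  have "\<exists>D. finite D \<and> card D = (if odd m then 1 else 0) \<and> (\<forall>x\<in>D. greal m x * (x - s) = 1 \<and> x < - 5 * real m \<and> m \<ge> 3)"
  proof (cases "odd m")
    case True
    then have "m \<ge> 3" using m by presburger
    then have "- 5 * real m - 3 - s \<le> -2" using s by linarith
    then have "1 * 2 \<le> (- greal m (- 5 * real m - 3)) * (- (- 5 * real m - 3 - s))"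
      using greal_below[OF True] by (intro mult_mono) auto
    then have pos: "greal m (- 5 * real m - 3) * (- 5 * real m - 3 - s) - 1 > 0"
      unfolding minus_mult_minus by linarith
    have eq: "greal m (- 5 * real m) * (- 5 * real m - s) - 1 = -1" using z[of m] m by simp
    have "\<exists>x. - 5 * real m - 3 < x \<and> x < - 5 * real m \<and> greal m x * (x - s) = 1"
    proof (rule root_between)
      show "(greal m (- 5 * real m - 3) * (- 5 * real m - 3 - s) - 1) *
          (greal m (- 5 * real m) * (- 5 * real m - s) - 1) < 0"
        unfolding eq mult_minus1_right neg_less_0_iff_less by (rule pos)
    qed simp
    then obtain x where "x < - 5 * real m" "greal m x * (x - s) = 1" by blast
    then show ?thesis using True \<open>m \<ge> 3\<close> by (intro exI[of _ "{x}"]) auto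
  qed (auto intro: exI[of _ "{}"])
  then obtain D where D: "finite D" "card D = (if odd m then 1 else 0)"
    "\<And>x. x \<in> D \<Longrightarrow> greal m x * (x - s) = 1 \<and> x < - 5 * real m \<and> m \<ge> 3" by metis
  \<comment> \<open>\<open>a j\<close> and \<open>b j\<close> both lie between -10 j and 5 - 10 j,
    and these intervals are disjoint for different j.\<close>
  have step: "i = j" if "-10 * real i < -10 * real j + 5" "-10 * real j < -10 * real i + 5" for i j
    using that by linarith
  have inja: "inj_on a {2..h}"
  proof (rule inj_onI)
    fix i j assume "i \<in> {2..h}" "j \<in> {2..h}" "a i = a j"
    with a[of i] a[of j] show "i = j" by (intro step) auto
  qed
  have injb: "inj_on b {2..h}"
  proof (rule inj_onI)
    fix i j assume "i \<in> {2..h}" "j \<in> {2..h}" "b i = b j"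
    with b[of i] b[of j] show "i = j" by (intro step) auto
  qed
  have ab: "a ` {2..h} \<inter> b ` {2..h} = {}"
  proof -
    have False if "i \<in> {2..h}" "j \<in> {2..h}" "a i = b j" for i j
    proof -
      have "i = j" using a[OF that(1)] b[OF that(2)] that(3) by (intro step) auto
      with a[OF that(1)] b[OF that(2)] that(3) show False by auto
    qed
    then show ?thesis by blast
  qed
  have rng: "- 5 * real m \<le> x \<and> x < -10" if "x \<in> a ` {2..h} \<union> b ` {2..h}" for x
  proof -
    from that obtain j where j: "j \<in> {2..h}" "x = a j \<or> x = b j" by auto
    then have "2 * j \<le> m" by (auto simp: h_def)
    then have "2 * real j \<le> real m" by linarith
    moreover have "real j \<ge> 2" using j by simp
    ultimately show ?thesis using a[OF j(1)] b[OF j(1)] j(2) by auto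
  qed
  have D10: "x < -10" if "x \<in> D" for x using D(3)[OF that] by auto
  define S where "S = insert t (D \<union> (a ` {2..h} \<union> b ` {2..h}))"
  have tn: "t \<notin> D \<union> (a ` {2..h} \<union> b ` {2..h})" using t D10 rng by fastforce
  have Dn: "D \<inter> (a ` {2..h} \<union> b ` {2..h}) = {}" using D(3) rng by fastforce
  have "card S = Suc (card D + (card {2..h} + card {2..h}))"
    unfolding S_def using tn Dn ab D(1) inja injb
    by (simp add: card_Un_disjoint card_image)
  also have "\<dots> = m - 1" using m D(2) by (auto simp: h_def) presburger+
  finally have "card S = m - 1" .
  moreover have "finite S" using D(1) by (simp add: S_def)
  moreover have "greal m x * (x - s) = 1 \<and> x \<notin> {-10..-5}" if "x \<in> S" for x
    using that t a b D(3) D10[of x] rng[of x] unfolding S_def by fastforce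
  ultimately show ?thesis by blast
qed

text \<open>For such \<open>s\<close> the remaining gap also behaves like the others: its midpoint
  -15/2 separates two further roots. The case needed is s = -1/M, that is t = 0.\<close>

lemma split_real:
  assumes m: "m \<ge> 2" and s: "-1 < s" "s < 0"
  shows "\<exists>S. finite S \<and> map_poly of_int (gpoly m) * [:-s, 1:] - 1 = (\<Prod>r\<in>S. [:-r, 1::real:])"
proof -
  obtain S where S: "finite S" "card S = m - 1" "\<And>x. x \<in> S \<Longrightarrow> greal m x * (x - s) = 1 \<and> x \<notin> {-10..-5}"
    using outer_roots[OF m, of s] s by auto
  have z: "greal m (-10) = 0" "greal m (-5) = 0"
    using greal_zero[of 2 m] greal_zero[of 1 m] m by auto
  have "1 * 2 \<le> (- greal m (- (15 / 2))) * (- (- (15 / 2) - s))"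
    using greal_mid[of 1 m] m s by (intro mult_mono) auto
  then have mid: "greal m (- (15 / 2)) * (- (15 / 2) - s) - 1 > 0"
    unfolding minus_mult_minus by linarith
  have "\<exists>x. -10 < x \<and> x < - (15 / 2) \<and> greal m x * (x - s) = 1"
    by (rule root_between) (use mid z in auto)
  then obtain a where a: "-10 < a" "a < - (15 / 2)" "greal m a * (a - s) = 1" by blast
  have "\<exists>x. - (15 / 2) < x \<and> x < -5 \<and> greal m x * (x - s) = 1"
    by (rule root_between) (use mid z in auto)
  then obtain b where b: "- (15 / 2) < b" "b < -5" "greal m b * (b - s) = 1" by blast
  have nin: "a \<notin> insert b S" "b \<notin> S" using a b S(3) by fastforce+
  have g: "lead_coeff (gpoly m) = 1" "degree (gpoly m) > 0"
    by (fact lead_coeff_gpoly) (use m in \<open>simp add: degree_gpoly\<close>)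
  have "map_poly of_int (gpoly m) * [:-s, 1:] - 1 = (\<Prod>r\<in>insert a (insert b S). [:-r, 1:])"
  proof (rule monic_eq_prod_roots)
    show "degree (map_poly of_int (gpoly m) * [:-s, 1:] - 1) = card (insert a (insert b S))"
      unfolding monic_equation(1)[OF g] using S nin m by (simp add: degree_gpoly)
    show "poly (map_poly of_int (gpoly m) * [:-s, 1:] - 1) x = 0" if "x \<in> insert a (insert b S)" for x
      using that a b S(3) by (auto simp: poly_gpoly algebra_simps)
    show "lead_coeff (map_poly of_int (gpoly m) * [:-s, 1:] - 1) = 1" by (rule monic_equation(2)[OF g])
  qed (use S in auto)
  then show ?thesis using S(1) by (intro exI[of _ "insert a (insert b S)"]) auto
qed

text \<open>In the gap from -10 to -5 the function x - 1 / g(x) tends to infinity at both ends. At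
  its minimum value the two roots of that gap merge, while the outer roots stay simple.\<close>

lemma double_root_real:
  assumes m: "m \<ge> 2"
  shows "\<exists>s x S. s < -6 \<and> finite S \<and> x \<notin> S \<and>
    map_poly of_int (gpoly m) * [:-s, 1:] - 1 = [:-x, 1:] * (\<Prod>r\<in>insert x S. [:-r, 1::real:])"
proof -
  have z: "greal m (-10) = 0" "greal m (-5) = 0"
    using greal_zero[of 2 m] greal_zero[of 1 m] m by auto
  \<comment> \<open>At the midpoint g \<le> -1, so the function is at most -15/2 + 1 there.\<close>
  define s0 :: real where "s0 = -13 / 2"
  \<comment> \<open>A compact set avoiding the zeros of g, on which the minimum is attained. In the
    rest of the open gap the function is at least \<open>s0\<close>.\<close>
  define C where "C = {x \<in> {-10..-5}. 1 \<le> greal m x * (x - s0)}"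
  have "C = {-10..-5} \<inter> {x. 1 \<le> greal m x * (x - s0)}" by (auto simp: C_def)
  moreover have "closed {x. 1 \<le> greal m x * (x - s0)}"
    by (intro closed_Collect_le continuous_intros continuous_greal)
  ultimately have "compact C" by (simp add: compact_Int_closed)
  have G0: "greal m x \<noteq> 0" if "x \<in> C" for x using that by (auto simp: C_def)
  have "- (15 / 2) \<in> C"
    using greal_mid[of 1 m] m by (simp add: C_def s0_def)
  have "continuous_on C (\<lambda>x. x - 1 / greal m x)"
    using G0 by (intro continuous_intros continuous_greal) auto
  with \<open>compact C\<close> \<open>- (15 / 2) \<in> C\<close> obtain xc where xc: "xc \<in> C"
    and min: "\<And>y. y \<in> C \<Longrightarrow> xc - 1 / greal m xc \<le> y - 1 / greal m y"
    using continuous_attains_inf[of C "\<lambda>x. x - 1 / greal m x"] by auto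
  define s where "s = xc - 1 / greal m xc"
  have neg: "greal m x < 0" if "-10 < x" "x < -5" for x using greal_neg[OF _ that] m by simp
  have "xc \<noteq> -10" "xc \<noteq> -5" using G0[OF xc] z by auto
  then have xc': "-10 < xc" "xc < -5" using xc by (auto simp: C_def)
  have "s > xc" using neg[OF xc'] by (simp add: s_def divide_less_0_iff)
  have "s \<le> s0"
  proof -
    have "1 / greal m (- (15 / 2)) \<ge> -1"
      using greal_mid[of 1 m] m by (simp add: divide_simps)
    with min[OF \<open>- (15 / 2) \<in> C\<close>] show ?thesis by (simp add: s_def s0_def)
  qed
  have qle: "greal m x * (x - s) \<le> 1" if x: "-10 < x" "x < -5" for x
  proof -
    have "s \<le> x - 1 / greal m x"
    proof (cases "x \<in> C")
      case True
      then show ?thesis using min s_def by simp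
    next
      case False
      then have "greal m x * (x - s0) < 1" using x by (simp add: C_def)
      then have "1 / greal m x \<le> x - s0" using neg[OF x] by (simp add: divide_simps mult.commute)
      with \<open>s \<le> s0\<close> show ?thesis by simp
    qed
    then have "1 / greal m x \<le> x - s" by simp
    then show ?thesis using neg[OF x] by (simp add: divide_simps mult.commute)
  qed
  have qc: "greal m xc * (xc - s) = 1" using G0[OF xc] by (simp add: s_def)
  define p where "p = map_poly of_int (gpoly m) * [:-s, 1:] - 1"
  have p: "poly p x = greal m x * (x - s) - 1" for x by (simp add: p_def poly_gpoly algebra_simps)
  obtain S where S: "finite S" "card S = m - 1" "\<And>x. x \<in> S \<Longrightarrow> greal m x * (x - s) = 1 \<and> x \<notin> {-10..-5}"
    using outer_roots[OF m, of s] \<open>s > xc\<close> xc' \<open>s \<le> s0\<close> s0_def by auto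
  have nin: "xc \<notin> S" using S(3) xc' by fastforce
  have g: "lead_coeff (gpoly m) = 1" "degree (gpoly m) > 0"
    by (fact lead_coeff_gpoly) (use m in \<open>simp add: degree_gpoly\<close>)
  \<comment> \<open>By \<open>qle\<close> the polynomial is at most 0 on the gap, with value 0 at
    \<open>xc\<close>: a local maximum.\<close>
  have "poly (pderiv p) xc = 0"
  proof (rule DERIV_local_max[OF poly_DERIV])
    show "0 < min (xc + 10) (-5 - xc)" using xc' by simp
    show "\<forall>y. \<bar>xc - y\<bar> < min (xc + 10) (-5 - xc) \<longrightarrow> poly p y \<le> poly p xc"
      using qle by (auto simp: p qc abs_if split: if_splits)
  qed
  have "poly p xc = 0" using qc by (simp add: p)
  then obtain r where r: "p = [:-xc, 1:] * r" by (auto simp: poly_eq_0_iff_dvd elim!: dvdE)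
  have "poly r xc = 0"
    using \<open>poly (pderiv p) xc = 0\<close> unfolding r pderiv_mult by (simp add: pderiv_pCons)
  have lp: "lead_coeff p = 1" "degree p = Suc m"
    unfolding p_def by (fact monic_equation(2)[OF g]) (simp only: monic_equation(1)[OF g] degree_gpoly)
  have "r \<noteq> 0" using r lp by auto
  have "r = (\<Prod>r\<in>insert xc S. [:-r, 1:])"
  proof (rule monic_eq_prod_roots)
    show "lead_coeff r = 1" using lp(1) unfolding r lead_coeff_mult by simp
    have "degree p = Suc (degree r)" unfolding r using \<open>r \<noteq> 0\<close> by (subst degree_mult_eq) auto
    then show "degree r = card (insert xc S)" using lp(2) S nin m by simp
    show "poly r x = 0" if "x \<in> insert xc S" for x
    proof (cases "x = xc")
      case False
      then have "poly p x = 0" using that S(3) by (simp add: p)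
      with False show ?thesis by (simp add: r)
    qed (use \<open>poly r xc = 0\<close> in simp)
  qed (use S in auto)
  then show ?thesis
    using S(1) nin r \<open>s \<le> s0\<close>
    by (intro exI[of _ s] exI[of _ xc] exI[of _ S]) (simp add: p_def s0_def)
qed

lemma double_root_complex:
  assumes "m \<ge> 2"
  shows "\<exists>s x S. s < -6 \<and> finite S \<and> x \<notin> S \<and>
    map_poly of_int (gpoly m) * [:-complex_of_real s, 1:] - 1 = [:-x, 1:] * (\<Prod>r\<in>insert x S. [:-r, 1:])"
proof -
  obtain s x and S :: "real set" where *: "s < -6" "finite S" "x \<notin> S"
    "map_poly of_int (gpoly m) * [:-s, 1:] - 1 = [:-x, 1:] * (\<Prod>r\<in>insert x S. [:-r, 1:])"
    using double_root_real[OF assms] by blast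
  interpret c: type_hom complex_of_real by unfold_locales (auto simp: hom_on_def)
  interpret p: type_hom "map_poly complex_of_real" by unfold_locales (rule c.map_hom)
  have g: "map_poly complex_of_real (map_poly of_int (gpoly m)) = map_poly of_int (gpoly m)"
    by (rule poly_eqI) (simp add: coeff_map_poly)
  have "map_poly complex_of_real (map_poly of_int (gpoly m) * [:-s, 1:] - 1) =
    map_poly complex_of_real ([:-x, 1:] * (\<Prod>r\<in>insert x S. [:-r, 1:]))" using *(4) by simp
  then have "map_poly of_int (gpoly m) * [:-complex_of_real s, 1:] - 1 =
      [:-complex_of_real x, 1:] * (\<Prod>r\<in>insert x S. [:-complex_of_real r, 1:])"
    unfolding p.hom_diff p.hom_mult p.hom_1 p.hom_prod c.map_hom_pCons g by simp
  also have "(\<Prod>r\<in>insert x S. [:-complex_of_real r, 1:]) =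
      (\<Prod>r\<in>insert (complex_of_real x) (complex_of_real ` S). [:-r, 1:])"
    by (subst image_insert[symmetric], subst prod.reindex) (auto simp: inj_on_def)
  finally show ?thesis using *(1-3)
    by (intro exI[of _ s] exI[of _ "complex_of_real x"] exI[of _ "complex_of_real ` S"]) auto
qed
subsection \<open>Galois groups and transpositions\<close>

lemma is_subfield_splitting_field_ac: "is_subfield (splitting_field_ac p)"
  and to_ac_in_splitting_field: "to_ac c \<in> splitting_field_ac p"
  and roots_in_splitting_field: "poly_roots_ac p \<subseteq> splitting_field_ac p"
  by (auto simp: splitting_field_ac_def is_subfield_def)

lemma splitting_field_ac_least:
  "is_subfield S \<Longrightarrow> range to_ac \<subseteq> S \<Longrightarrow> poly_roots_ac p \<subseteq> S \<Longrightarrow> splitting_field_ac p \<subseteq> S"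
  by (auto simp: splitting_field_ac_def)

lemma galois_autsD:
  assumes "\<sigma> \<in> galois_auts p"
  shows "\<sigma> \<in> extensional (splitting_field_ac p)"
    "bij_betw \<sigma> (splitting_field_ac p) (splitting_field_ac p)"
    "subfield_hom (splitting_field_ac p) \<sigma>" "\<sigma> (to_ac c) = to_ac c"
  using assms is_subfield_splitting_field_ac[of p]
  by (auto simp: galois_auts_def Let_def subfield_hom_def hom_on_def)

lemma galois_autsI:
  assumes "\<sigma> \<in> extensional (splitting_field_ac p)"
    "bij_betw \<sigma> (splitting_field_ac p) (splitting_field_ac p)"
    "hom_on (splitting_field_ac p) \<sigma>" "\<And>c. \<sigma> (to_ac c) = to_ac c"
  shows "\<sigma> \<in> galois_auts p"
  using assms by (auto simp: galois_auts_def Let_def hom_on_def)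

lemma galois_auts_root:
  assumes "\<sigma> \<in> galois_auts p" "z \<in> poly_roots_ac p"
  shows "\<sigma> z \<in> poly_roots_ac p"
proof -
  interpret subfield_hom "splitting_field_ac p" \<sigma> by (rule galois_autsD(3)[OF assms(1)])
  have F: "map_poly to_ac p \<in> polys_over (splitting_field_ac p)"
    by (simp add: polys_over_def coeff_map_poly to_ac_in_splitting_field)
  have "map_poly \<sigma> (map_poly to_ac p) = map_poly to_ac p"
    by (rule poly_eqI) (simp add: coeff_map_poly galois_autsD(4)[OF assms(1)])
  then show ?thesis
    using hom_poly[OF F, of z] assms(2) roots_in_splitting_field[of p] by (auto simp: poly_roots_ac_def)
qed

lemma galois_auts_comp:
  assumes "\<sigma> \<in> galois_auts p" "\<tau> \<in> galois_auts p"
  shows "restrict (\<sigma> \<circ> \<tau>) (splitting_field_ac p) \<in> galois_auts p"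
proof (rule galois_autsI)
  let ?L = "splitting_field_ac p"
  interpret s: subfield_hom ?L \<sigma> by (rule galois_autsD(3)[OF assms(1)])
  interpret t: subfield_hom ?L \<tau> by (rule galois_autsD(3)[OF assms(2)])
  have \<tau>L: "\<tau> x \<in> ?L" if "x \<in> ?L" for x
    using galois_autsD(2)[OF assms(2)] that by (auto simp: bij_betw_def)
  show "bij_betw (restrict (\<sigma> \<circ> \<tau>) ?L) ?L ?L"
    using bij_betw_trans[OF galois_autsD(2)[OF assms(2)] galois_autsD(2)[OF assms(1)]]
    by (simp cong: bij_betw_cong)
  show "hom_on ?L (restrict (\<sigma> \<circ> \<tau>) ?L)"
    by (auto simp: hom_on_def s.hom_add s.hom_mult t.hom_add t.hom_mult \<tau>L s.add_mem s.mult_mem)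
  show "restrict (\<sigma> \<circ> \<tau>) ?L (to_ac c) = to_ac c" for c
    using galois_autsD(4)[OF assms(1)] galois_autsD(4)[OF assms(2)] by (simp add: to_ac_in_splitting_field)
qed simp

lemma galois_auts_id: "restrict id (splitting_field_ac p) \<in> galois_auts p"
proof (rule galois_autsI)
  let ?L = "splitting_field_ac p"
  show "bij_betw (restrict id ?L) ?L ?L" by (auto simp: bij_betw_def inj_on_def)
  show "hom_on ?L (restrict id ?L)"
    using is_subfield_splitting_field_ac[of p] by (auto simp: hom_on_def is_subfield_def)
qed (auto simp: to_ac_in_splitting_field)

text \<open>The set where two automorphisms agree is a subfield containing all generators of the
  splitting field.\<close>

lemma galois_auts_eqI:
  assumes "\<sigma> \<in> galois_auts p" "\<tau> \<in> galois_auts p"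
    and eq: "\<And>z. z \<in> poly_roots_ac p \<Longrightarrow> \<sigma> z = \<tau> z"
  shows "\<sigma> = \<tau>"
proof -
  let ?L = "splitting_field_ac p"
  interpret s: subfield_hom ?L \<sigma> by (rule galois_autsD(3)[OF assms(1)])
  interpret t: subfield_hom ?L \<tau> by (rule galois_autsD(3)[OF assms(2)])
  have "?L \<subseteq> {x \<in> ?L. \<sigma> x = \<tau> x}"
  proof (rule splitting_field_ac_least)
    show "is_subfield {x \<in> ?L. \<sigma> x = \<tau> x}"
      by (auto simp: is_subfield_def s.add_mem s.mult_mem s.uminus_mem s.inverse_mem s.hom_add t.hom_add
          s.hom_mult t.hom_mult s.hom_uminus t.hom_uminus s.hom_inverse t.hom_inverse)
  qed (use eq roots_in_splitting_field[of p] in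
      \<open>auto simp: to_ac_in_splitting_field galois_autsD(4)[OF assms(1)] galois_autsD(4)[OF assms(2)]\<close>)
  then show ?thesis
    by (intro extensionalityI[OF galois_autsD(1)[OF assms(1)] galois_autsD(1)[OF assms(2)]]) auto
qed

text \<open>The action on a numbering of the roots is a homomorphism, injective because the roots
  generate the splitting field. It is surjective because every permutation is a product of
  transpositions.\<close>

lemma galois_group_iso_sym_group:
  fixes p :: "'k::field poly"
  assumes R: "finite (poly_roots_ac p)" "card (poly_roots_ac p) = n"
    and swap: "\<And>x y. x \<in> poly_roots_ac p \<Longrightarrow> y \<in> poly_roots_ac p \<Longrightarrow> x \<noteq> y \<Longrightarrow>
      \<exists>\<sigma>\<in>galois_auts p. \<forall>z\<in>poly_roots_ac p. \<sigma> z = Transposition.transpose x y z"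
  shows "galois_group p \<cong> sym_group n"
proof -
  let ?L = "splitting_field_ac p" and ?R = "poly_roots_ac p"
  obtain b where b: "bij_betw b {1..n} ?R"
    using ex_bij_betw_nat_finite_1[OF R(1)] R(2) by auto
  define b' where "b' = inv_into {1..n} b"
  have b'b: "b' (b i) = i" if "i \<in> {1..n}" for i
    using b that by (simp add: b'_def bij_betw_def)
  have bb': "b (b' z) = z" "b' z \<in> {1..n}" if "z \<in> ?R" for z
    using b that bij_betwE[OF bij_betw_inv_into[OF b]] unfolding b'_def
    by (auto simp: bij_betw_def f_inv_into_f simp del: atLeastAtMost_iff)
  have bR: "b i \<in> ?R" if "i \<in> {1..n}" for i
    using b that by (auto simp: bij_betw_def)
  define \<Phi> where "\<Phi> = (\<lambda>\<sigma> i. if i \<in> {1..n} then b' (\<sigma> (b i)) else i)"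
  have inj\<sigma>: "inj_on \<sigma> ?R" if "\<sigma> \<in> galois_auts p" for \<sigma>
    using galois_autsD(2)[OF that] roots_in_splitting_field[of p] by (auto simp: bij_betw_def intro: inj_on_subset)
  have perm: "\<Phi> \<sigma> permutes {1..n}" if \<sigma>: "\<sigma> \<in> galois_auts p" for \<sigma>
  proof (rule bij_imp_permutes)
    have "\<Phi> \<sigma> ` {1..n} \<subseteq> {1..n}"
      using bb' bR galois_auts_root[OF \<sigma>] by (auto simp: \<Phi>_def)
    moreover have "inj_on (\<Phi> \<sigma>) {1..n}"
    proof (rule inj_onI)
      fix i j assume ij: "i \<in> {1..n}" "j \<in> {1..n}" "\<Phi> \<sigma> i = \<Phi> \<sigma> j"
      then have "\<sigma> (b i) = \<sigma> (b j)"
        using bb'(1) bR galois_auts_root[OF \<sigma>] unfolding \<Phi>_def by metis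
      then have "b i = b j" using inj\<sigma>[OF \<sigma>] bR ij by (auto dest: inj_onD)
      then show "i = j" using b'b ij by metis
    qed
    ultimately show "bij_betw (\<Phi> \<sigma>) {1..n} {1..n}"
      by (simp add: bij_betw_def endo_inj_surj)
  qed (auto simp: \<Phi>_def)
  have comp: "\<Phi> (restrict (\<sigma> \<circ> \<tau>) ?L) = \<Phi> \<sigma> \<circ> \<Phi> \<tau>"
    if \<sigma>: "\<sigma> \<in> galois_auts p" and \<tau>: "\<tau> \<in> galois_auts p" for \<sigma> \<tau>
  proof
    fix i
    show "\<Phi> (restrict (\<sigma> \<circ> \<tau>) ?L) i = (\<Phi> \<sigma> \<circ> \<Phi> \<tau>) i"
      using bR[of i] bb'[of "\<tau> (b i)"] galois_auts_root[OF \<tau>, of "b i"] roots_in_splitting_field[of p]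
      by (auto simp: \<Phi>_def)
  qed
  have "\<Phi> \<in> hom (galois_group p) (sym_group n)"
    using perm comp by (auto simp: hom_def galois_group_def sym_group_def)
  moreover have "inj_on \<Phi> (galois_auts p)"
  proof (rule inj_onI)
    fix \<sigma> \<tau> assume \<sigma>: "\<sigma> \<in> galois_auts p" and \<tau>: "\<tau> \<in> galois_auts p" and eq: "\<Phi> \<sigma> = \<Phi> \<tau>"
    show "\<sigma> = \<tau>"
    proof (rule galois_auts_eqI[OF \<sigma> \<tau>])
      fix z assume z: "z \<in> ?R"
      then have "b' (\<sigma> z) = b' (\<tau> z)"
        using fun_cong[OF eq, of "b' z"] bb'[OF z] by (simp add: \<Phi>_def)
      then show "\<sigma> z = \<tau> z" using bb'(1) galois_auts_root[OF \<sigma> z] galois_auts_root[OF \<tau> z] by metis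
    qed
  qed
  moreover have "\<exists>\<sigma>\<in>galois_auts p. \<Phi> \<sigma> = q" if "q permutes {1..n}" for q
    using finite_atLeastAtMost that
  proof (induction rule: permutes_rev_induct)
    case id
    have "\<Phi> (restrict id ?L) = id"
      using b'b bR roots_in_splitting_field[of p] by (auto simp: \<Phi>_def fun_eq_iff)
    then show ?case using galois_auts_id by blast
  next
    case (swap i j q)
    then obtain \<sigma> where \<sigma>: "\<sigma> \<in> galois_auts p" "\<Phi> \<sigma> = q" by blast
    have "b i \<noteq> b j" using swap b'b by metis
    then obtain \<tau> where \<tau>: "\<tau> \<in> galois_auts p" "\<And>z. z \<in> ?R \<Longrightarrow> \<tau> z = Transposition.transpose (b i) (b j) z"
      using assms(3)[of "b i" "b j"] bR swap by blast
    have "\<Phi> \<tau> = Transposition.transpose i j"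
    proof
      fix k
      show "\<Phi> \<tau> k = Transposition.transpose i j k"
      proof (cases "k \<in> {1..n}")
        case True
        have "b k = b i \<longleftrightarrow> k = i" "b k = b j \<longleftrightarrow> k = j"
          using b'b True swap by metis+
        then show ?thesis using True \<tau>(2)[OF bR[OF True]] b'b swap
          by (auto simp: \<Phi>_def Transposition.transpose_def)
      next
        case False
        then show ?thesis using swap by (auto simp: \<Phi>_def Transposition.transpose_def)
      qed
    qed
    with comp[OF \<sigma>(1) \<tau>(1)] \<sigma> galois_auts_comp[OF \<sigma>(1) \<tau>(1)] show ?case by metis
  qed
  then have "\<Phi> ` galois_auts p = {q. q permutes {1..n}}" using perm by blast
  ultimately have "\<Phi> \<in> iso (galois_group p) (sym_group n)"
    by (simp add: iso_def bij_betw_def galois_group_def sym_group_def)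
  then show ?thesis by (auto simp: is_iso_def)
qed

text \<open>\<open>\<theta>\<close> fixes the image of the base field and permutes the images of the
  roots, so it preserves the image of the splitting field and can be pulled back along the injective
  \<open>h\<close>.\<close>

lemma ex_galois_aut_of_involution:
  fixes p :: "'k::field poly" and h :: "'k alg_closure \<Rightarrow> 'b::field" and \<theta> :: "'b \<Rightarrow> 'b"
  assumes h: "subfield_hom E h" and L: "range to_ac \<subseteq> E" "poly_roots_ac p \<subseteq> E"
    and \<theta>: "hom_on UNIV \<theta>" "\<And>x. \<theta> (\<theta> x) = x"
    and base: "\<And>c. \<theta> (h (to_ac c)) = h (to_ac c)"
    and roots: "\<And>z. z \<in> poly_roots_ac p \<Longrightarrow> \<pi> z \<in> poly_roots_ac p \<and> \<theta> (h z) = h (\<pi> z)"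
  shows "\<exists>\<sigma>\<in>galois_auts p. \<forall>z\<in>poly_roots_ac p. \<sigma> z = \<pi> z"
proof -
  let ?L = "splitting_field_ac p"
  interpret h: subfield_hom E h by (rule h)
  interpret \<theta>: type_hom \<theta> by unfold_locales (rule \<theta>(1))
  have \<theta>inv: "\<theta> (inverse x) = inverse (\<theta> x)" for x
    using \<theta>.hom_mult[of x "inverse x"] by (cases "x = 0") (auto intro: inverse_unique[symmetric])
  have LE: "?L \<subseteq> E" by (rule splitting_field_ac_least[OF h.subfield L])
  interpret L: subfield_hom ?L h
    using h.hom LE by unfold_locales (auto simp: is_subfield_splitting_field_ac hom_on_def)
  have "?L \<subseteq> {x \<in> ?L. \<exists>y\<in>?L. \<theta> (h x) = h y}"
  proof (rule splitting_field_ac_least)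
    show "is_subfield {x \<in> ?L. \<exists>y\<in>?L. \<theta> (h x) = h y}"
      unfolding is_subfield_def
    proof (intro conjI ballI)
      show "0 \<in> {x \<in> ?L. \<exists>y\<in>?L. \<theta> (h x) = h y}" by (auto intro: bexI[of _ 0])
      show "1 \<in> {x \<in> ?L. \<exists>y\<in>?L. \<theta> (h x) = h y}" by (auto intro: bexI[of _ 1])
      fix x assume "x \<in> {x \<in> ?L. \<exists>y\<in>?L. \<theta> (h x) = h y}"
      then obtain y where x: "x \<in> ?L" "y \<in> ?L" "\<theta> (h x) = h y" by blast
      show "- x \<in> {x \<in> ?L. \<exists>y\<in>?L. \<theta> (h x) = h y}"
        using x by (auto simp: L.uminus_mem L.hom_uminus \<theta>.hom_uminus intro!: bexI[of _ "- y"])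
      show "inverse x \<in> {x \<in> ?L. \<exists>y\<in>?L. \<theta> (h x) = h y}"
        using x by (auto simp: L.inverse_mem L.hom_inverse \<theta>inv intro!: bexI[of _ "inverse y"])
      fix x' assume "x' \<in> {x \<in> ?L. \<exists>y\<in>?L. \<theta> (h x) = h y}"
      then obtain y' where x': "x' \<in> ?L" "y' \<in> ?L" "\<theta> (h x') = h y'" by blast
      show "x + x' \<in> {x \<in> ?L. \<exists>y\<in>?L. \<theta> (h x) = h y}"
        using x x' by (auto simp: L.add_mem L.hom_add \<theta>.hom_add intro!: bexI[of _ "y + y'"])
      show "x * x' \<in> {x \<in> ?L. \<exists>y\<in>?L. \<theta> (h x) = h y}"
        using x x' by (auto simp: L.mult_mem L.hom_mult \<theta>.hom_mult intro!: bexI[of _ "y * y'"])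
    qed
    show "range to_ac \<subseteq> {x \<in> ?L. \<exists>y\<in>?L. \<theta> (h x) = h y}"
      using base to_ac_in_splitting_field by blast
    show "poly_roots_ac p \<subseteq> {x \<in> ?L. \<exists>y\<in>?L. \<theta> (h x) = h y}"
      using roots roots_in_splitting_field[of p] by blast
  qed
  then have "\<exists>y\<in>?L. \<theta> (h x) = h y" if "x \<in> ?L" for x using that by blast
  then obtain s where s: "\<And>x. x \<in> ?L \<Longrightarrow> s x \<in> ?L" "\<And>x. x \<in> ?L \<Longrightarrow> h (s x) = \<theta> (h x)" by metis
  have eqI: "s x = y" if "x \<in> ?L" "y \<in> ?L" "h y = \<theta> (h x)" for x y
    using L.hom_eq_iff[of "s x" y] s that by simp
  \<comment> \<open>The pullback of an involution is its own inverse, which gives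
    bijectivity.\<close>
  have ss: "s (s x) = x" if "x \<in> ?L" for x
    using that s \<theta>(2) by (intro eqI) auto
  have "restrict s ?L \<in> galois_auts p"
  proof (rule galois_autsI)
    have "bij_betw s ?L ?L"
      by (rule bij_betw_byWitness[where f' = s]) (use s ss in auto)
    then show "bij_betw (restrict s ?L) ?L ?L" by (simp cong: bij_betw_cong)
    show "hom_on ?L (restrict s ?L)"
      unfolding hom_on_def using s
      by (auto simp: L.add_mem L.mult_mem L.hom_add L.hom_mult \<theta>.hom_add \<theta>.hom_mult intro!: eqI)
    show "restrict s ?L (to_ac c) = to_ac c" for c
      using base by (auto simp: to_ac_in_splitting_field intro!: eqI)
  qed simp
  moreover have "restrict s ?L z = \<pi> z" if "z \<in> poly_roots_ac p" for z
    using roots[OF that] roots_in_splitting_field[of p] that by (auto intro!: eqI)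
  ultimately show ?thesis by blast
qed
subsection \<open>The equation over the rational function field\<close>

definition gpoly_scale :: "nat \<Rightarrow> int" where
  "gpoly_scale m = (\<Prod>k\<in>{1..m}. 5 * int k)"

definition s_param :: "nat \<Rightarrow> nat \<Rightarrow> rat poly" where
  "s_param m l = smult (1 / of_int (gpoly_scale m)) ([:0, 1:] ^ l - 1)"

lemma gpoly_scale_ge: "m \<ge> 1 \<Longrightarrow> gpoly_scale m \<ge> 5"
proof -
  assume "m \<ge> 1"
  then have "{1..m} = insert 1 {2..m}" by auto
  then have "gpoly_scale m = 5 * (\<Prod>k\<in>{2..m}. 5 * int k)" by (simp add: gpoly_scale_def)
  moreover have "1 \<le> (\<Prod>k\<in>{2..m}. 5 * int k)" by (rule prod_ge_1) auto
  ultimately show ?thesis by simp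
qed

text \<open>The product of the a_i is (-1)^(n-1) M, so the sign in the definition of f
  cancels.\<close>

lemma fpoly_eq:
  "fpoly n l (\<lambda>i. - 5 * (int i + 1)) = map_poly of_int (gpoly (n - 1)) * [:- s_param (n - 1) l, 1:] - 1"
proof -
  define m where "m = n - 1"
  have "(\<Prod>i<m. [:- [:rat_of_int (- 5 * (int i + 1)):], 1:]) = map_poly of_int (gpoly m)"
    unfolding map_gpoly One_nat_def prod.atLeast1_atMost_eq
    by (intro prod.cong refl) (simp add: of_nat_poly numeral_poly)
  moreover have "(\<Prod>i<m. rat_of_int (- 5 * (int i + 1))) = (-1) ^ m * of_int (gpoly_scale m)"
  proof -
    have "(\<Prod>i<m. rat_of_int (- 5 * (int i + 1))) = (\<Prod>i<m. - 1 * rat_of_int (5 * int (Suc i)))"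
      by (intro prod.cong refl) simp
    also have "\<dots> = (-1) ^ m * of_int (gpoly_scale m)"
      by (subst prod.distrib) (simp only: prod_constant card_lessThan gpoly_scale_def One_nat_def prod.atLeast1_atMost_eq of_int_prod)
    finally show ?thesis .
  qed
  ultimately show ?thesis
    unfolding fpoly_def s_param_def m_def[symmetric] by simp
qed

text \<open>Used for two specializations of Q[t]: the embedding into the closure of Q(t), and
  evaluation at t = 0.\<close>

lemma map_fpoly:
  fixes h :: "rat poly \<Rightarrow> 'b::comm_ring_1"
  assumes "hom_on UNIV h"
  shows "map_poly h (fpoly n l (\<lambda>i. - 5 * (int i + 1))) =
    map_poly of_int (gpoly (n - 1)) * [:- h (s_param (n - 1) l), 1:] - 1"
proof -
  interpret h: type_hom h by unfold_locales (rule assms)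
  interpret p: type_hom "map_poly h" by unfold_locales (rule h.map_hom)
  have "map_poly h (map_poly of_int (gpoly (n - 1))) = map_poly of_int (gpoly (n - 1))"
    by (rule poly_eqI) (simp add: coeff_map_poly h.hom_of_int)
  then show ?thesis
    unfolding fpoly_eq p.hom_diff p.hom_mult by (simp add: h.hom_uminus)
qed

text \<open>A nonconstant common divisor would vanish at some real root r, but the derivative there
  is the product of the differences from r to the other roots.\<close>

lemma separable_if_split:
  assumes m: "m > 0" and S: "finite S"
    "map_poly of_int (gpoly m) * [:- of_rat s, 1:] - 1 = (\<Prod>r\<in>S. [:-r, 1::real:])"
  shows "separable_poly (map_poly of_int (gpoly m) * [:-s, 1:] - 1 :: rat poly)"
  unfolding separable_poly_def
proof (rule coprimeI)
  define f :: "rat poly" where "f = map_poly of_int (gpoly m) * [:-s, 1:] - 1"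
  interpret q: type_hom "of_rat :: rat \<Rightarrow> real" by unfold_locales (auto simp: hom_on_def of_rat_add of_rat_mult)
  interpret p: type_hom "map_poly (of_rat :: rat \<Rightarrow> real)" by unfold_locales (rule q.map_hom)
  have "map_poly of_rat (map_poly of_int (gpoly m)) = (map_poly of_int (gpoly m) :: real poly)"
    by (rule poly_eqI) (simp add: coeff_map_poly)
  then have f: "map_poly of_rat f = (\<Prod>r\<in>S. [:-r, 1:])"
    unfolding f_def p.hom_diff p.hom_mult S(2)[symmetric] by (simp add: of_rat_minus)
  have f': "map_poly of_rat (pderiv f) = pderiv (map_poly of_rat f :: real poly)"
    by (rule poly_eqI) (simp add: coeff_map_poly coeff_pderiv of_rat_mult del: of_nat_Suc)
  fix d assume "d dvd map_poly of_int (gpoly m) * [:-s, 1:] - 1"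
    and d': "d dvd pderiv (map_poly of_int (gpoly m) * [:-s, 1:] - 1)"
  then have d: "d dvd f" "d dvd pderiv f" by (auto simp: f_def)
  have "f \<noteq> 0"
    using f S(1) by auto
  then have "d \<noteq> 0" using d(1) by auto
  have "degree d = 0"
  proof (rule ccontr)
    assume "degree d \<noteq> 0"
    have deg: "degree (map_poly of_rat d :: real poly) = degree d"
      by (rule degree_map_poly) auto
    have dv: "(map_poly of_rat d :: real poly) dvd map_poly of_rat f"
      "(map_poly of_rat d :: real poly) dvd map_poly of_rat (pderiv f)"
      using d by (auto elim!: dvdE simp: p.hom_mult)
    obtain r where r: "r \<in> S" "poly (map_poly of_rat d) r = 0"
      using dvd_prod_linear_imp_root[OF S(1), of "map_poly of_rat d"] dv(1) deg \<open>degree d \<noteq> 0\<close> f by auto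
    have "map_poly of_rat f = [:-r, 1:] * (\<Prod>r\<in>S - {r}. [:-r, 1::real:])"
      unfolding f using S(1) r(1) by (rule prod.remove)
    then have "poly (map_poly of_rat (pderiv f)) r = poly (\<Prod>r\<in>S - {r}. [:-r, 1:]) r"
      unfolding f' by (simp only: pderiv_mult) (simp add: pderiv_pCons)
    also have "\<dots> \<noteq> 0" using S(1) by (auto simp: poly_prod)
    finally show False using dv(2) r(2) by (auto elim!: dvdE)
  qed
  with \<open>d \<noteq> 0\<close> show "is_unit d" by (simp add: is_unit_iff_degree)
qed

section \<open>Counting the roots in an algebraically closed field\<close>

lemma alg_closed_split:
  fixes p :: "'a::alg_closed_field poly"
  assumes "lead_coeff p = 1" "\<And>x. poly p x = 0 \<Longrightarrow> poly (pderiv p) x \<noteq> 0"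
  shows "card {x. poly p x = 0} = degree p"
  using assms
proof (induction "degree p" arbitrary: p)
  case 0
  then obtain c where "p = [:c:]" by (metis degree_eq_zeroE)
  with 0 have "p = 1" by (simp add: one_pCons)
  then show ?case by simp
next
  case (Suc n)
  then obtain a where a: "poly p a = 0"
    using alg_closed_imp_poly_has_root[of p] by auto
  then obtain q where q: "p = [:-a, 1:] * q" by (auto simp: poly_eq_0_iff_dvd elim!: dvdE)
  have "q \<noteq> 0" using Suc.prems(1) q by auto
  have deg: "degree p = Suc (degree q)" unfolding q using \<open>q \<noteq> 0\<close> by (subst degree_mult_eq) auto
  have lc: "lead_coeff q = 1" using Suc.prems(1) unfolding q lead_coeff_mult by simp
  have p': "poly (pderiv p) x = poly q x + (x - a) * poly (pderiv q) x" for x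
    unfolding q by (simp only: pderiv_mult) (simp add: pderiv_pCons algebra_simps)
  have "poly (pderiv q) x \<noteq> 0" if "poly q x = 0" for x
    using Suc.prems(2)[of x] that p'[of x] by (auto simp: q)
  then have IH: "card {x. poly q x = 0} = degree q"
    using Suc.hyps lc deg by auto
  have "{x. poly p x = 0} = insert a {x. poly q x = 0}" by (auto simp: q)
  moreover have "poly q a \<noteq> 0" using Suc.prems(2)[OF a] p'[of a] by auto
  ultimately show ?case using IH deg poly_roots_finite[OF \<open>q \<noteq> 0\<close>] by simp
qed

text \<open>At a double root of g(x)(x - s) - 1, also g' + g^2 vanishes; so a double root is algebraic.\<close>

lemma equation_roots_simple:
  fixes s \<alpha> :: "'a::idom"
  assumes g: "lead_coeff g = 1" "degree g > 0" and s: "transcendental_int s"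
    and root: "poly (map_poly of_int g * [:-s, 1:] - 1) \<alpha> = 0"
  shows "poly (pderiv (map_poly of_int g * [:-s, 1:] - 1)) \<alpha> \<noteq> 0"
proof
  let ?G = "map_poly of_int g :: 'a poly"
  assume 0: "poly (pderiv (?G * [:-s, 1:] - 1)) \<alpha> = 0"
  interpret i: type_hom "of_int :: int \<Rightarrow> 'a" by unfold_locales (rule hom_on_of_int)
  interpret p: type_hom "map_poly (of_int :: int \<Rightarrow> 'a)" by unfold_locales (rule i.map_hom)
  have eq: "poly ?G \<alpha> * (\<alpha> - s) = 1" using root by (simp add: algebra_simps)
  have "poly (pderiv ?G) \<alpha> * (\<alpha> - s) + poly ?G \<alpha> = 0"
  proof -
    have "pderiv (?G * [:-s, 1:] - 1) = ?G * pderiv [:-s, 1:] + [:-s, 1:] * pderiv ?G"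
      by (simp only: pderiv_diff pderiv_mult pderiv_1 diff_zero)
    with 0 have "poly (?G * pderiv [:-s, 1:] + [:-s, 1:] * pderiv ?G) \<alpha> = 0" by (simp only:)
    then show ?thesis by (simp add: pderiv_pCons algebra_simps)
  qed
  \<comment> \<open>Multiplying by g(\<alpha>) and using g(\<alpha>) (\<alpha> - s) = 1 eliminates
    s.\<close>
  then have "poly ?G \<alpha> * (poly (pderiv ?G) \<alpha> * (\<alpha> - s) + poly ?G \<alpha>) = 0" by simp
  also have "poly ?G \<alpha> * (poly (pderiv ?G) \<alpha> * (\<alpha> - s) + poly ?G \<alpha>) =
      poly (pderiv ?G) \<alpha> * (poly ?G \<alpha> * (\<alpha> - s)) + poly ?G \<alpha> * poly ?G \<alpha>"
    by (simp add: algebra_simps)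
  finally have 1: "poly (pderiv ?G) \<alpha> + poly ?G \<alpha> * poly ?G \<alpha> = 0" by (simp add: eq)
  have "map_poly of_int (pderiv g) = pderiv ?G"
    by (rule poly_eqI) (simp add: coeff_map_poly coeff_pderiv)
  then have "poly (map_poly of_int (pderiv g + g * g)) \<alpha> = 0"
    unfolding p.hom_add p.hom_mult using 1 by simp
  with transcendental_root[OF s eq] have "pderiv g + g * g = 0" by (simp add: transcendental_int_def)
  \<comment> \<open>Degree 2 N cannot equal the degree of the derivative, which is below N.\<close>
  then have "degree (g * g) = degree (pderiv g)" by (metis add_eq_0_iff degree_minus)
  moreover have "degree (g * g) = 2 * degree g" using g by (subst degree_mult_eq) auto
  ultimately show False using g degree_pderiv[of g] by linarith
qed

section \<open>The rational function field inside its closure, and the transpositions\<close>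

type_synonym qt_closure = "rat poly fract alg_closure"

definition embed_Qt :: "rat poly \<Rightarrow> qt_closure" where
  "embed_Qt p = to_ac (to_fract p)"

lemma hom_embed_Qt: "hom_on UNIV embed_Qt"
  by (auto simp: hom_on_def embed_Qt_def)

lemma transcendental_embed_Qt:
  assumes "degree q > 0"
  shows "transcendental_int (embed_Qt q)"
  unfolding transcendental_int_def
proof (intro allI impI)
  fix c :: "int poly" assume "poly (map_poly of_int c) (embed_Qt q) = 0"
  interpret e: type_hom embed_Qt by unfold_locales (rule hom_embed_Qt)
  interpret i: type_hom "of_int :: int \<Rightarrow> rat" by unfold_locales (rule hom_on_of_int)
  interpret j: type_hom "of_int :: int \<Rightarrow> qt_closure" by unfold_locales (rule hom_on_of_int)
  have "embed_Qt (pcompose (map_poly of_int c) q) = poly (map_poly of_int c) (embed_Qt q)"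
  proof (induction c)
    case (pCons a c)
    have "embed_Qt [:of_int a:] = of_int a" using e.hom_of_int[of a] by (simp add: of_int_poly)
    with pCons show ?case by (simp add: pcompose_pCons e.hom_add e.hom_mult)
  qed (simp add: e.hom_0)
  with \<open>poly _ _ = 0\<close> have "pcompose (map_poly of_int c) q = (0 :: rat poly)" by (simp add: embed_Qt_def)
  then have "map_poly of_int c = (0 :: rat poly)" using assms by (rule pcompose_eq_0)
  then show "c = 0" by (auto simp: poly_eq_iff coeff_map_poly)
qed

text \<open>A subfield contains the rationals, and t generates Q(t) over them. Fixing Q(t) thus
  reduces to fixing the single element t.\<close>

lemma range_to_ac_subset:
  fixes S :: "qt_closure set"
  assumes S: "is_subfield S" and t: "embed_Qt [:0, 1:] \<in> S"
  shows "range to_ac \<subseteq> S"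
proof -
  interpret S: subfield_hom S id by unfold_locales (auto simp: S hom_on_def)
  interpret e: type_hom embed_Qt by unfold_locales (rule hom_embed_Qt)
  have const: "embed_Qt [:r:] \<in> S" for r
  proof -
    obtain a b where "quotient_of r = (a, b)" by force
    then have ab: "r = of_int a / of_int b" "b > 0"
      using quotient_of_div quotient_of_denom_pos by auto
    have "embed_Qt [:of_int c:] = of_int c" for c using e.hom_of_int[of c] by (simp add: of_int_poly)
    moreover have "[:r:] * [:of_int b:] = [:of_int a:]" using ab by simp
    then have "embed_Qt [:r:] * embed_Qt [:of_int b:] = embed_Qt [:of_int a:]" by (metis e.hom_mult)
    moreover have "embed_Qt [:of_int b:] \<noteq> 0" using ab by (simp add: embed_Qt_def)
    ultimately have "embed_Qt [:r:] = of_int a / of_int b" by (simp add: field_simps)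
    then show ?thesis by (simp add: S.divide_mem S.of_int_mem)
  qed
  have poly: "embed_Qt p \<in> S" for p
  proof (induction p)
    case (pCons a p)
    have "pCons a p = [:a:] + [:0, 1:] * p" by simp
    then have "embed_Qt (pCons a p) = embed_Qt [:a:] + embed_Qt [:0, 1:] * embed_Qt p" by (metis e.hom_add e.hom_mult)
    with pCons show ?case by (simp add: S.add_mem S.mult_mem const t)
  qed (simp add: e.hom_0)
  show ?thesis
  proof (intro subsetI, elim rangeE)
    fix x and c :: "rat poly fract" assume "x = to_ac c"
    obtain a b where "c = Fract a b" "b \<noteq> 0" by (cases c) auto
    then have "c = to_fract a / to_fract b" by (simp add: Fract_conv_to_fract)
    then have "x = embed_Qt a / embed_Qt b" using \<open>x = to_ac c\<close> by (simp add: embed_Qt_def)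
    then show "x \<in> S" using poly by (simp add: S.divide_mem)
  qed
qed

lemma gpoly_eq: "gpoly m = (\<Prod>a\<in>(\<lambda>k. - (5 * int k)) ` {1..m}. [:-a, 1:])"
  unfolding gpoly_def by (subst prod.reindex) (auto simp: inj_on_def)

lemma eq_diff_inverse: "b * (a - s) = 1 \<Longrightarrow> s = a - 1 / b" for a b s :: "'a::field"
  by (cases "b = 0") (auto simp: field_simps)

text \<open>The local model swaps one particular pair, while \<open>x\<close> and \<open>y\<close>
  are arbitrary. Equality of kernels allows this pair to be sent to the swapped one.\<close>

lemma ex_transposition:
  fixes p :: "rat poly fract poly"
  assumes m: "m \<ge> 2" and l: "l > 0"
    and p: "map_poly to_ac p = map_poly of_int (gpoly m) * [:- embed_Qt (s_param m l), 1:] - 1"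
    and xy: "x \<in> poly_roots_ac p" "y \<in> poly_roots_ac p" "x \<noteq> y"
  shows "\<exists>\<sigma>\<in>galois_auts p. \<forall>z\<in>poly_roots_ac p. \<sigma> z = Transposition.transpose x y z"
proof -
  let ?R = "poly_roots_ac p"
  define s where "s = embed_Qt (s_param m l)"
  have g: "lead_coeff (gpoly m) = 1" "degree (gpoly m) > 0"
    by (fact lead_coeff_gpoly) (use m in \<open>simp add: degree_gpoly\<close>)
  have M5: "gpoly_scale m \<ge> 5" using gpoly_scale_ge m by simp
  have dl: "degree ([:0, 1:] ^ l - 1 :: rat poly) = l"
    unfolding diff_conv_add_uminus using l by (subst degree_add_eq_left) (auto simp: degree_power_eq)
  have s_trans: "transcendental_int s"
    unfolding s_def by (rule transcendental_embed_Qt) (use M5 l dl in \<open>simp add: s_param_def\<close>)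
  have R: "z \<in> ?R \<longleftrightarrow> poly (map_poly of_int (gpoly m)) z * (z - s) = 1" for z
    by (simp add: poly_roots_ac_def p s_def algebra_simps)
  obtain sc :: real and xc :: complex and S where S: "sc < -6" "finite S" "xc \<notin> S"
    "map_poly of_int (gpoly m) * [:-complex_of_real sc, 1:] - 1 = [:-xc, 1:] * (\<Prod>r\<in>insert xc S. [:-r, 1:])"
    using double_root_complex[OF m] by blast
  have "of_int (gpoly_scale m) * complex_of_real sc + 1 \<noteq> 0"
  proof -
    have "5 * 6 \<le> real_of_int (gpoly_scale m) * (- sc)" using M5 S(1) by (intro mult_mono) auto
    then have "real_of_int (gpoly_scale m) * sc + 1 \<noteq> 0" by simp
    then have "complex_of_real (real_of_int (gpoly_scale m) * sc + 1) \<noteq> 0" by (simp only: of_real_eq_0_iff not_False_eq_True)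
    then show ?thesis by simp
  qed
  from local_model[OF g S(2-4) this l] obtain s' \<rho>0 \<rho>1 T Z where loc:
    "transcendental_int s'" "\<rho>0 \<noteq> \<rho>1" "fls_reflect \<rho>0 = \<rho>1" "fls_reflect \<rho>1 = \<rho>0" "finite T" "\<And>\<rho>. \<rho> \<in> T \<Longrightarrow> fls_reflect \<rho> = \<rho>"
    "map_poly of_int (gpoly m) * [:-s', 1:] - 1 = (\<Prod>\<rho>\<in>insert \<rho>0 (insert \<rho>1 T). [:-\<rho>, 1:])"
    "finite Z" "\<And>z. z \<in> Z \<Longrightarrow> fls_reflect z = z"
    "monom 1 l - [:of_int (gpoly_scale m) * s' + 1:] = (\<Prod>z\<in>Z. [:-z, 1:])"
    by blast
  have \<rho>: "poly (map_poly of_int (gpoly m)) \<rho> * (\<rho> - s') = 1" if "\<rho> \<in> {\<rho>0, \<rho>1}" for \<rho>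
  proof -
    have "poly (map_poly of_int (gpoly m) * [:-s', 1:] - 1) \<rho> = 0"
      unfolding loc(7) using that loc(5) by (auto simp: poly_prod)
    then show ?thesis by (simp add: algebra_simps)
  qed
  define A :: "int set" where "A = (\<lambda>k. - (5 * int k)) ` {1..m}"
  have A: "finite A" "A \<noteq> {}" "\<And>a. a \<in> A \<Longrightarrow> 5 dvd a" "\<not> 5 dvd (1 :: int)"
    using m by (auto simp: A_def)
  have gA: "gpoly m = (\<Prod>a\<in>A. [:-a, 1:])" unfolding A_def by (rule gpoly_eq)
  have ker: "eval2 x y B = 0 \<longleftrightarrow> eval2 \<rho>0 \<rho>1 B = 0" for B
    using eval2_eq_0_iff[OF A gA s_trans xy(3) _ _ loc(1,2) \<rho> \<rho>] xy R by simp
  interpret e: type_hom "eval2 x y" by unfold_locales (rule hom_on_eval2)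
  interpret e': type_hom "eval2 \<rho>0 \<rho>1" by unfold_locales (rule hom_on_eval2)
  \<comment> \<open>The graph of the map sending P(x, y) to P at the swapped pair, for integer
    polynomials P.\<close>
  define \<Gamma> where "\<Gamma> = range (\<lambda>B. (eval2 x y B, eval2 \<rho>0 \<rho>1 B))"
  have "\<exists>E h. subfield_hom E h \<and> (\<forall>(x, y)\<in>\<Gamma>. x \<in> E \<and> h x = y)"
  proof (rule fraction_hom)
    show "(1, 1) \<in> \<Gamma>" unfolding \<Gamma>_def by (rule range_eqI[of _ _ 1]) simp
    show "(u + u', v + v') \<in> \<Gamma>" if uv: "(u, v) \<in> \<Gamma>" "(u', v') \<in> \<Gamma>" for u v u' v'
    proof -
      from uv obtain B B' where "u = eval2 x y B" "v = eval2 \<rho>0 \<rho>1 B" "u' = eval2 x y B'" "v' = eval2 \<rho>0 \<rho>1 B'"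
        by (auto simp: \<Gamma>_def)
      then show ?thesis unfolding \<Gamma>_def by (intro range_eqI[of _ _ "B + B'"]) (simp add: e.hom_add e'.hom_add)
    qed
    show "(u * u', v * v') \<in> \<Gamma>" if uv: "(u, v) \<in> \<Gamma>" "(u', v') \<in> \<Gamma>" for u v u' v'
    proof -
      from uv obtain B B' where "u = eval2 x y B" "v = eval2 \<rho>0 \<rho>1 B" "u' = eval2 x y B'" "v' = eval2 \<rho>0 \<rho>1 B'"
        by (auto simp: \<Gamma>_def)
      then show ?thesis unfolding \<Gamma>_def by (intro range_eqI[of _ _ "B * B'"]) (simp add: e.hom_mult e'.hom_mult)
    qed
    show "(- u, - v) \<in> \<Gamma>" if uv: "(u, v) \<in> \<Gamma>" for u v
    proof -
      from uv obtain B where "u = eval2 x y B" "v = eval2 \<rho>0 \<rho>1 B" by (auto simp: \<Gamma>_def)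
      then show ?thesis unfolding \<Gamma>_def by (intro range_eqI[of _ _ "- B"]) (simp add: e.hom_uminus e'.hom_uminus)
    qed
    show "u = 0 \<longleftrightarrow> v = 0" if "(u, v) \<in> \<Gamma>" for u v
      using that ker by (auto simp: \<Gamma>_def)
  qed
  then obtain E0 h0 where E0: "subfield_hom E0 h0" and \<Gamma>: "\<And>u v. (u, v) \<in> \<Gamma> \<Longrightarrow> u \<in> E0 \<and> h0 u = v"
    by fast
  interpret E0: subfield_hom E0 h0 by (rule E0)
  have "(x, \<rho>0) \<in> \<Gamma>" unfolding \<Gamma>_def by (rule range_eqI[of _ _ "[:0, 1:]"]) (simp add: eval2_def map_poly_pCons)
  then have x: "x \<in> E0" "h0 x = \<rho>0" using \<Gamma> by auto
  have "(y, \<rho>1) \<in> \<Gamma>" unfolding \<Gamma>_def by (rule range_eqI[of _ _ "[:[:0, 1:]:]"]) (simp add: eval2_def map_poly_pCons)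
  then have y: "y \<in> E0" "h0 y = \<rho>1" using \<Gamma> by auto
  let ?G = "map_poly of_int (gpoly m) :: qt_closure poly"
  have G: "?G \<in> polys_over E0" by (auto simp: polys_over_def coeff_map_poly E0.of_int_mem)
  have hG: "map_poly h0 ?G = map_poly of_int (gpoly m)"
    by (rule poly_eqI) (simp add: coeff_map_poly E0.hom_of_int)
  \<comment> \<open>The parameter is a rational expression in one root, s = x - 1 / g(x), so its
    image is forced.\<close>
  have s: "s \<in> E0" "h0 s = s'"
  proof -
    have "s = x - 1 / poly ?G x" using xy R by (intro eq_diff_inverse) blast
    moreover have "s' = \<rho>0 - 1 / poly (map_poly of_int (gpoly m)) \<rho>0"
      using \<rho> by (intro eq_diff_inverse) simp
    ultimately show "s \<in> E0" "h0 s = s'"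
      using x E0.poly_mem[OF G x(1)] E0.hom_poly[OF G x(1)]
      by (auto simp: hG E0.diff_mem E0.divide_mem E0.hom_diff E0.hom_divide)
  qed
  have pE0: "map_poly to_ac p \<in> polys_over E0"
    unfolding p s_def[symmetric] using s
    by (intro E0.polys_over_diff E0.polys_over_mult G) (auto simp: E0.polys_over_pCons E0.uminus_mem)
  have hp: "map_poly h0 (map_poly to_ac p) = (\<Prod>\<rho>\<in>insert \<rho>0 (insert \<rho>1 T). [:-\<rho>, 1:])"
  proof -
    have lin: "[:-s, 1:] \<in> polys_over E0" using s by (auto simp: E0.polys_over_pCons E0.uminus_mem)
    have "map_poly h0 [:-s, 1:] = [:-s', 1:]" using s by (simp add: E0.hom_uminus)
    moreover have "map_poly h0 1 = 1" by (simp add: map_poly_1 one_pCons)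
    ultimately show ?thesis
      unfolding p s_def[symmetric] loc(7)[symmetric]
      by (simp only: E0.map_hom_diff E0.map_hom_mult E0.polys_over_mult G lin E0.polys_over_1 hG)
  qed
  have p0: "map_poly to_ac p \<noteq> 0"
  proof -
    have "lead_coeff (map_poly to_ac p) = 1"
      unfolding p by (rule monic_equation(2)[OF g])
    then show ?thesis by auto
  qed
  let ?t = "embed_Qt [:0, 1:]"
  \<comment> \<open>t need not lie in the field of the pair, but it is a zero of X^l - (M s + 1),
    whose coefficients do.\<close>
  define q :: "qt_closure poly" where "q = monom 1 l - [:of_int (gpoly_scale m) * s + 1:]"
  interpret emb: type_hom embed_Qt by unfold_locales (rule hom_embed_Qt)
  have tq: "poly q ?t = 0"
  proof -
    have "[:of_int (gpoly_scale m):] * s_param m l + 1 = [:0, 1:] ^ l" using M5 by (simp add: s_param_def)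
    then have "embed_Qt [:of_int (gpoly_scale m):] * embed_Qt (s_param m l) + 1 = ?t ^ l"
      by (metis emb.hom_add emb.hom_mult emb.hom_1 emb.hom_power)
    moreover have "embed_Qt [:of_int (gpoly_scale m):] = of_int (gpoly_scale m)"
      using emb.hom_of_int[of "gpoly_scale m"] by (simp add: of_int_poly)
    ultimately show ?thesis by (simp add: q_def poly_monom s_def)
  qed
  have cE0: "of_int (gpoly_scale m) * s + 1 \<in> E0" using s by (simp add: E0.add_mem E0.mult_mem E0.of_int_mem)
  then have qE0: "q \<in> polys_over E0"
    unfolding q_def by (intro E0.polys_over_diff E0.polys_over_monom) (auto simp: E0.polys_over_pCons)
  have hq: "map_poly h0 q = (\<Prod>z\<in>Z. [:-z, 1:])"
  proof -
    have "h0 (of_int (gpoly_scale m) * s + 1) = of_int (gpoly_scale m) * s' + 1"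
      using s by (simp add: E0.hom_add E0.hom_mult E0.mult_mem E0.of_int_mem E0.hom_of_int)
    then have "map_poly h0 q = monom 1 l - [:of_int (gpoly_scale m) * s' + 1:]"
      unfolding q_def using cE0
      by (intro poly_eqI) (auto simp: E0.hom_diff coeff_pCons split: nat.splits)
    then show ?thesis using loc(10) by simp
  qed
  have q0: "q \<noteq> 0"
  proof
    assume "q = 0"
    then have "coeff q l = 0" by simp
    then show False using l by (simp add: q_def coeff_pCons split: nat.splits)
  qed
  have finR: "finite ?R" using poly_roots_finite[OF p0] by (simp add: poly_roots_ac_def)
  have "\<exists>E h. subfield_hom E h \<and> insert ?t ?R \<union> E0 \<subseteq> E \<and> (\<forall>x\<in>E0. h x = h0 x)"
  proof (rule E0.extend_adjoin_finite)
    fix a assume "a \<in> insert ?t ?R"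
    then show "\<exists>q S. q \<in> polys_over E0 \<and> q \<noteq> 0 \<and> poly q a = 0 \<and> finite S \<and> map_poly h0 q = (\<Prod>b\<in>S. [:- b, 1:])"
    proof
      assume "a = ?t"
      then show ?thesis using qE0 q0 tq loc(8) hq
        by (intro exI[of _ q] exI[of _ Z] conjI) (simp_all only: not_False_eq_True)
    next
      assume "a \<in> ?R"
      then have "poly (map_poly to_ac p) a = 0" by (simp add: poly_roots_ac_def)
      then show ?thesis using pE0 p0 hp loc(5)
        by (intro exI[of _ "map_poly to_ac p"] exI[of _ "insert \<rho>0 (insert \<rho>1 T)"] conjI)
          (simp_all only: finite_insert not_False_eq_True)
    qed
  qed (use finR in simp)
  then obtain E h where E: "subfield_hom E h" "insert ?t ?R \<subseteq> E" "E0 \<subseteq> E" "\<And>x. x \<in> E0 \<Longrightarrow> h x = h0 x"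
    by auto
  interpret E: subfield_hom E h by (rule E(1))
  have map_eq: "map_poly h r = map_poly h0 r" if "r \<in> polys_over E0" for r
    using that E(4) by (intro poly_eqI) (simp add: E0.polys_over_mem)
  have hroot: "poly (map_poly h0 r) (h a) = 0" if "r \<in> polys_over E0" "a \<in> E" "poly r a = 0" for r a
  proof -
    have "r \<in> polys_over E" using that(1) E(3) by (auto simp: polys_over_def)
    then show ?thesis using E.hom_poly[OF _ that(2)] that map_eq by (metis E.hom_0)
  qed
  \<comment> \<open>The extension does not control which element of \<open>Z\<close> is the image of
    t; all of them are fixed.\<close>
  have t_fixed: "fls_reflect (h ?t) = h ?t"
  proof -
    have "poly (\<Prod>z\<in>Z. [:-z, 1:]) (h ?t) = 0" using hroot[OF qE0 _ tq] E(2) hq by simp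
    then have "h ?t \<in> Z" using loc(8) by (auto simp: poly_prod)
    then show ?thesis by (rule loc(9))
  qed
  interpret reflect: type_hom fls_reflect by unfold_locales (rule hom_fls_reflect)
  have reflect_inverse: "fls_reflect (inverse x) = inverse (fls_reflect x)" for x
    using reflect.hom_mult[of x "inverse x"] by (cases "x = 0") (auto intro: inverse_unique[symmetric])
  have base: "range to_ac \<subseteq> {x \<in> E. fls_reflect (h x) = h x}"
  proof (rule range_to_ac_subset)
    show "is_subfield {x \<in> E. fls_reflect (h x) = h x}"
      by (auto simp: is_subfield_def E.add_mem E.mult_mem E.uminus_mem E.inverse_mem E.hom_add E.hom_mult
          E.hom_uminus E.hom_inverse reflect.hom_add reflect.hom_mult reflect.hom_uminus reflect_inverse)
  qed (use E(2) t_fixed in simp)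
  have hx: "h x = \<rho>0" "h y = \<rho>1" using E(4) x y by auto
  have xyE: "x \<in> E" "y \<in> E" using E(3) x y by auto
  show ?thesis
  proof (rule ex_galois_aut_of_involution[OF E(1) _ _ hom_fls_reflect fls_reflect_involution])
    show "range to_ac \<subseteq> E" "poly_roots_ac p \<subseteq> E" using base E(2) by auto
    show "fls_reflect (h (to_ac c)) = h (to_ac c)" for c using base by blast
    fix z assume z: "z \<in> ?R"
    then have "z \<in> E" using E(2) by auto
    have "poly (\<Prod>\<rho>\<in>insert \<rho>0 (insert \<rho>1 T). [:-\<rho>, 1:]) (h z) = 0"
      using hroot[OF pE0 \<open>z \<in> E\<close>] z hp by (simp add: poly_roots_ac_def)
    then have "h z \<in> insert \<rho>0 (insert \<rho>1 T)" using loc(5) by (auto simp: poly_prod)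
    then consider "h z = h x" | "h z = h y" | "h z \<in> T" using hx by auto
    then show "Transposition.transpose x y z \<in> ?R \<and> fls_reflect (h z) = h (Transposition.transpose x y z)"
    proof cases
      case 1
      then have "z = x" using E.hom_eq_iff \<open>z \<in> E\<close> xyE by blast
      then show ?thesis using xy hx loc(3) by simp
    next
      case 2
      then have "z = y" using E.hom_eq_iff \<open>z \<in> E\<close> xyE by blast
      then show ?thesis using xy hx loc(4) by simp
    next
      case 3
      then have "fls_reflect (h z) = h z" by (rule loc(6))
      \<comment> \<open>The reflection moves both swapped branches, so neither belongs to
        \<open>T\<close>.\<close>
      moreover have "z \<noteq> x" "z \<noteq> y" using 3 hx loc(2,3,4,6) by metis+
      ultimately show ?thesis using z by (simp add: Transposition.transpose_def)
    qed
  qed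
qed

theorem theorem5p1:
  fixes n l :: nat
  assumes "n \<ge> 3" and "l \<ge> 1"
  shows "\<exists>a :: nat \<Rightarrow> int.
           inj_on a {..<n-1} \<and> (\<forall>i<n-1. a i \<noteq> 0)
         \<and> galois_group (fpoly_Qt n l a) \<cong> sym_group n
         \<and> separable_poly (fpoly_at0 n l a)"
proof -
  define m where "m = n - 1"
  define a where "a = (\<lambda>i. - 5 * (int i + 1))"
  define p where "p = fpoly_Qt n l a"
  have m: "m \<ge> 2" using assms by (simp add: m_def)
  have g: "lead_coeff (gpoly m) = 1" "degree (gpoly m) > 0"
    by (fact lead_coeff_gpoly) (use m in \<open>simp add: degree_gpoly\<close>)
  have M5: "gpoly_scale m \<ge> 5" using gpoly_scale_ge m by simp
  have p: "map_poly to_ac p = map_poly of_int (gpoly m) * [:- embed_Qt (s_param m l), 1:] - 1"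
    using map_fpoly[OF hom_embed_Qt, of n l]
    by (simp only: p_def fpoly_Qt_def a_def m_def map_poly_map_poly to_fract_0 to_ac_0 o_def embed_Qt_def[abs_def])
  have dl: "degree ([:0, 1:] ^ l - 1 :: rat poly) = l"
    unfolding diff_conv_add_uminus using assms by (subst degree_add_eq_left) (auto simp: degree_power_eq)
  have tr: "transcendental_int (embed_Qt (s_param m l))"
    by (rule transcendental_embed_Qt) (use M5 assms dl in \<open>simp add: s_param_def\<close>)
  \<comment> \<open>All roots are simple because s is transcendental, so there are exactly n of
    them.\<close>
  have "card {x. poly (map_poly to_ac p) x = 0} = degree (map_poly to_ac p)"
    unfolding p by (rule alg_closed_split[OF monic_equation(2)[OF g] equation_roots_simple[OF g tr]])
  also have "\<dots> = n" unfolding p monic_equation(1)[OF g] using assms by (simp add: degree_gpoly m_def)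
  finally have card: "card (poly_roots_ac p) = n" by (simp add: poly_roots_ac_def)
  then have "finite (poly_roots_ac p)" using assms by (intro card_ge_0_finite) simp
  then have "galois_group p \<cong> sym_group n"
    using card ex_transposition[OF m _ p] assms by (intro galois_group_iso_sym_group) auto
  moreover have "separable_poly (fpoly_at0 n l a)"
  proof -
    define s where "s = poly (s_param m l) 0"
    \<comment> \<open>Here l \<ge> 1 matters, since 0^l must be 0.\<close>
    have s: "s = - 1 / of_int (gpoly_scale m)" using assms by (simp add: s_def s_param_def zero_power)
    have "-1 < (of_rat s :: real)" "(of_rat s :: real) < 0"
      using M5 by (auto simp: s of_rat_divide of_rat_minus)
    then obtain S where "finite S" "map_poly of_int (gpoly m) * [:- of_rat s, 1:] - 1 = (\<Prod>r\<in>S. [:-r, 1::real:])"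
      using split_real[OF m] by blast
    then have "separable_poly (map_poly of_int (gpoly m) * [:-s, 1:] - 1 :: rat poly)"
      using m by (intro separable_if_split) auto
    moreover have "fpoly_at0 n l a = map_poly of_int (gpoly m) * [:-s, 1:] - 1"
      unfolding fpoly_at0_def a_def m_def s_def by (rule map_fpoly) (auto simp: hom_on_def)
    ultimately show ?thesis by simp
  qed
  moreover have "inj_on a {..<n-1} \<and> (\<forall>i<n-1. a i \<noteq> 0)"
    by (auto simp: a_def inj_on_def)
  ultimately show ?thesis unfolding p_def by blast
qed

end
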